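(* Let $a,b,c_1,c_2,c_3$ be real constants and set $$\mathfrak{C}=ac_1+bc_2+2c_1^2+2c_2^2,\qquad \mathfrak{B}=2c_1a+3c_1^2+c_2b+3c_2^2 .$$ Let $u=u(z)$ be a smooth solution of $u'(z)^2+e^{2u(z)}+c_3^2e^{-6u(z)}-\mathfrak{C}=0$. Suppose that the equation $$\alpha^3+a\alpha^2-\mathfrak{B}\alpha+c_1\mathfrak{C}=0$$ has three distinct roots, denoted by $\alpha_1,\alpha_2,\alpha_3$, and write $\beta_j=\dfrac{c_2\alpha_j}{\alpha_j-c_1}$ for $j=1,2,3$. Let $$P(z)=e^{u(z)+ic_3\int e^{-3u(z)}dz},\qquad Q(z)=\sqrt{\mathfrak{C}-e^{2u(z)}}\;e^{ic_3\int\frac{e^{-u(z)}}{e^{2u(z)}-\mathfrak{C}}dz},$$ $$\gamma_1=\sqrt{\tfrac{\mathfrak{C}+\alpha_2\alpha_3}{\mathfrak{C}(\alpha_1-\alpha_2)(\alpha_1-\alpha_3)}},\quad \gamma_2=\sqrt{\tfrac{\mathfrak{C}+\alpha_1\alpha_3}{\mathfrak{C}(\alpha_2-\alpha_1)(\alpha_2-\alpha_3)}},\quad \gamma_3=\sqrt{\tfrac{\mathfrak{C}+\alpha_1\alpha_2}{\mathfrak{C}(\alpha_3-\alpha_1)(\alpha_3-\alpha_2)}},\quad \gamma_4=\sqrt{\tfrac1{\mathfrak{C}}} .$$ Then the map $\mathcal{H}\circ\psi:\mathbb{R}^3\to\mathbb{CP}^3$ defines a conformally flat H-minimal Lagrangian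 immersion in $\mathbb{CP}^3$, where $\mathcal{H}:\mathbb{S}^7\to\mathbb{CP}^3$ is the Hopf map and the map $\psi:\mathbb{R}^3\to\mathbb{S}^7\subset\mathbb{C}^4$ is given by $$\psi(x,y,z)=\bigl(\gamma_1P(z)e^{i(x\alpha_1+y\beta_1)},\ \gamma_2P(z)e^{i(x\alpha_2+y\beta_2)},\ \gamma_3P(z)e^{i(x\alpha_3+y\beta_3)},\ \gamma_4Q(z)\bigr).$$
   Context: $\mathbb{S}^7$ is the unit sphere in $\mathbb{C}^4$ with Hermitian product $\langle u,v\rangle=\sum_{k=1}^4u_k\bar v_k$. $\mathbb{CP}^3$ carries the Fubini–Study Hermitian structure, the product of two tangent vectors being the Hermitian product of their horizontal lifts by $\mathcal{H}$; the metric is its real part and the Kähler form $\omega$ its imaginary part. An immersion $f$ of a 3-manifold into $\mathbb{CP}^3$ is Lagrangian if $f^*\omega=0$. A Lagrangian submanifold is Hamiltonian-minimal (H-minimal) if it is a critical point of the volume under Hamiltonian deformations. "Conformally flat" means that the induced metric in the coordinates $(x,y,z)$ is a positive function times $dx^2+dy^2+dz^2$. An integral sign without limits denotes an antiderivative in $z$; $u'=du/dz$.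
   Formalization: Added: α_j ≠ c_1, so that β_j is defined, and e^{2u(z)} ≠ 𝔠 for all z; the latter holds automatically if c_3 ≠ 0 and excludes c_3 = 0, where every solution on ℝ reaches e^{2u} = 𝔠 and the map is not a smooth immersion there. *)

theory Defs
  imports "HOL-Analysis.Analysis"
begin

section \<open>Smooth maps\<close>

text \<open>Only used on open sets \<open>S\<close>.\<close>

primrec Ck_on :: "nat \<Rightarrow> ('a::real_normed_vector \<Rightarrow> 'b::real_normed_vector) \<Rightarrow> 'a set \<Rightarrow> bool" where
  "Ck_on 0 f S \<longleftrightarrow> continuous_on S f"
| "Ck_on (Suc k) f S \<longleftrightarrow>
     (\<forall>x\<in>S. f differentiable (at x)) \<and> (\<forall>v. Ck_on k (\<lambda>x. frechet_derivative f (at x) v) S)"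

definition smooth_on :: "('a::real_normed_vector \<Rightarrow> 'b::real_normed_vector) \<Rightarrow> 'a set \<Rightarrow> bool" where
  "smooth_on f S \<longleftrightarrow> (\<forall>k. Ck_on k f S)"


section \<open>The Hopf map and maps into \<open>\<complex>P\<^sup>3\<close>\<close>

definition herm :: "complex^4 \<Rightarrow> complex^4 \<Rightarrow> complex" where
  "herm u v = (\<Sum>k\<in>UNIV. u $ k * cnj (v $ k))"

abbreviation S7 :: "(complex^4) set" where
  "S7 \<equiv> sphere 0 1"

text \<open>A point of \<open>\<complex>P\<^sup>3\<close> is an orbit of the circle action on \<open>S7\<close>.\<close>

definition hopf :: "complex^4 \<Rightarrow> (complex^4) set" where
  "hopf p = {c *s p | c. cmod c = 1}"

definition CP3 :: "(complex^4) set set" where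
  "CP3 = hopf ` S7"

text \<open>
  The smooth structure of \<open>\<complex>P\<^sup>3\<close> is the one making \<open>hopf\<close> a submersion. As a submersion has smooth
  local sections, a map into \<open>\<complex>P\<^sup>3\<close> is smooth iff it locally has smooth lifts to \<open>S7\<close>.
\<close>

definition local_lift ::
    "('a::real_normed_vector \<Rightarrow> (complex^4) set) \<Rightarrow> 'a \<Rightarrow> ('a \<Rightarrow> complex^4) \<Rightarrow> bool" where
  "local_lift f x \<psi> \<longleftrightarrow>
     (\<exists>U. open U \<and> x \<in> U \<and> smooth_on \<psi> U \<and> (\<forall>y\<in>U. \<psi> y \<in> S7 \<and> hopf (\<psi> y) = f y))"

definition smooth_to_CP3 :: "('a::real_normed_vector \<Rightarrow> (complex^4) set) \<Rightarrow> 'a set \<Rightarrow> bool" where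
  "smooth_to_CP3 f S \<longleftrightarrow> (\<forall>x\<in>S. \<exists>\<psi>. local_lift f x \<psi>)"


section \<open>The Fubini--Study Hermitian structure, pulled back by a map\<close>

text \<open>
  The kernel of the differential of \<open>hopf\<close> at \<open>p\<close> is spanned over the reals by \<open>\<i>p\<close>, and the
  horizontal vectors at \<open>p\<close> are those Hermitian-orthogonal to \<open>p\<close>. So if \<open>\<psi>\<close> lifts \<open>f\<close> near \<open>x\<close>,
  the following is the horizontal lift at \<open>\<psi> x\<close> of the tangent vector \<open>df\<^sub>x(v)\<close>.
\<close>

definition hor_part :: "complex^4 \<Rightarrow> complex^4 \<Rightarrow> complex^4" where
  "hor_part p w = w - herm w p *s p"

definition hor_lift :: "('a::real_normed_vector \<Rightarrow> complex^4) \<Rightarrow> 'a \<Rightarrow> 'a \<Rightarrow> complex^4" where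
  "hor_lift \<psi> x v = hor_part (\<psi> x) (frechet_derivative \<psi> (at x) v)"

text \<open>
  \<open>tangent_lift f x v\<close> represents \<open>df\<^sub>x(v)\<close> by its horizontal lift at some point over \<open>f x\<close>. The
  lemmas below show that another choice of the local lift multiplies it by a unit complex number
  depending on \<open>x\<close> only, so that neither \<open>fs_herm\<close> nor injectivity of \<open>tangent_lift f x\<close> depends on
  the choice.
\<close>

definition tangent_lift :: "('a::real_normed_vector \<Rightarrow> (complex^4) set) \<Rightarrow> 'a \<Rightarrow> 'a \<Rightarrow> complex^4" where
  "tangent_lift f x = hor_lift (SOME \<psi>. local_lift f x \<psi>) x"

definition fs_herm :: "('a::real_normed_vector \<Rightarrow> (complex^4) set) \<Rightarrow> 'a \<Rightarrow> 'a \<Rightarrow> 'a \<Rightarrow> complex" where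
  "fs_herm f x v w = herm (tangent_lift f x v) (tangent_lift f x w)"

definition fs_metric :: "('a::real_normed_vector \<Rightarrow> (complex^4) set) \<Rightarrow> 'a \<Rightarrow> 'a \<Rightarrow> 'a \<Rightarrow> real" where
  "fs_metric f x v w = Re (fs_herm f x v w)"

definition fs_omega :: "('a::real_normed_vector \<Rightarrow> (complex^4) set) \<Rightarrow> 'a \<Rightarrow> 'a \<Rightarrow> 'a \<Rightarrow> real" where
  "fs_omega f x v w = Im (fs_herm f x v w)"

lemma bounded_bilinear_herm: "bounded_bilinear herm"
proof -
  have eq: "herm = (\<lambda>u v. \<Sum>k\<in>UNIV. u $ k * cnj (v $ k))"
    by (simp add: fun_eq_iff herm_def)
  have "bilinear herm"
    unfolding bilinear_def eq
    by (auto intro!: linearI simp: algebra_simps sum.distrib scaleR_sum_right)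
  then show ?thesis
    by (simp add: bilinear_conv_bounded_bilinear)
qed

lemma bounded_bilinear_scale:
  "bounded_bilinear (\<lambda>(c::complex) (u::complex^4). c *s u)"
proof -
  have "bilinear (\<lambda>(c::complex) (u::complex^4). c *s u)"
    unfolding bilinear_def
    by (auto intro!: linearI simp: vec_eq_iff algebra_simps)
  then show ?thesis
    by (simp add: bilinear_conv_bounded_bilinear)
qed

lemma herm_algebra:
  "herm (u + v) w = herm u w + herm v w" "herm u (v + w) = herm u v + herm u w"
  "herm (u - v) w = herm u w - herm v w" "herm u (v - w) = herm u v - herm u w"
  "herm (c *s u) v = c * herm u v" "herm u (c *s v) = cnj c * herm u v"
  by (simp_all add: herm_def algebra_simps sum.distrib sum_subtractf sum_distrib_left)

lemma herm_self: "herm u u = complex_of_real ((norm u)\<^sup>2)"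
proof -
  have "complex_of_real ((norm u)\<^sup>2) = (\<Sum>k\<in>UNIV. complex_of_real ((cmod (u $ k))\<^sup>2))"
    by (simp add: norm_vec_def L2_set_def sum_nonneg flip: of_real_sum of_real_power)
  also have "\<dots> = herm u u"
    unfolding herm_def by (intro sum.cong refl complex_norm_square)
  finally show ?thesis ..
qed

lemma local_lift_unique:
  assumes "local_lift f x \<phi>" "local_lift f x \<psi>"
  obtains c where "cmod c = 1" "\<And>v. hor_lift \<phi> x v = c *s hor_lift \<psi> x v"
proof -
  from assms obtain U V where U: "open U" "x \<in> U" "smooth_on \<phi> U"
      "\<And>y. y \<in> U \<Longrightarrow> \<phi> y \<in> S7 \<and> hopf (\<phi> y) = f y"
    and V: "open V" "x \<in> V" "smooth_on \<psi> V"
      "\<And>y. y \<in> V \<Longrightarrow> \<psi> y \<in> S7 \<and> hopf (\<psi> y) = f y"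
    unfolding local_lift_def by metis
  define c where "c y = herm (\<phi> y) (\<psi> y)" for y
  have c: "\<phi> y = c y *s \<psi> y \<and> cmod (c y) = 1" if "y \<in> U \<inter> V" for y
  proof -
    have "\<phi> y \<in> hopf (\<phi> y)"
      unfolding hopf_def by (auto intro!: exI[of _ 1])
    then have "\<phi> y \<in> hopf (\<psi> y)"
      using U(4) V(4) that by auto
    then obtain d where d: "cmod d = 1" "\<phi> y = d *s \<psi> y"
      by (auto simp: hopf_def)
    have "c y = d"
      using V(4)[of y] that by (simp add: c_def d(2) herm_algebra herm_self)
    with d show ?thesis by simp
  qed
  from U(3) have "Ck_on (Suc 0) \<phi> U" unfolding smooth_on_def by blast
  then have d\<phi>: "(\<phi> has_derivative frechet_derivative \<phi> (at x)) (at x)"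
    using U(2) by (simp add: frechet_derivative_works)
  from V(3) have "Ck_on (Suc 0) \<psi> V" unfolding smooth_on_def by blast
  then have d\<psi>: "(\<psi> has_derivative frechet_derivative \<psi> (at x)) (at x)"
    using V(2) by (simp add: frechet_derivative_works)
  define c' where "c' v = herm (\<phi> x) (frechet_derivative \<psi> (at x) v) +
    herm (frechet_derivative \<phi> (at x) v) (\<psi> x)" for v
  have dc: "(c has_derivative c') (at x)"
    unfolding c_def c'_def by (rule bounded_bilinear.FDERIV[OF bounded_bilinear_herm d\<phi> d\<psi>])
  have "((\<lambda>y. c y *s \<psi> y) has_derivative
      (\<lambda>v. c x *s frechet_derivative \<psi> (at x) v + c' v *s \<psi> x)) (at x)"
    by (rule bounded_bilinear.FDERIV[OF bounded_bilinear_scale dc d\<psi>])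
  then have "(\<phi> has_derivative
      (\<lambda>v. c x *s frechet_derivative \<psi> (at x) v + c' v *s \<psi> x)) (at x)"
    by (rule has_derivative_transform_within_open[of _ _ _ _ "U \<inter> V"])
       (use U V c in auto)
  then have "frechet_derivative \<phi> (at x) =
      (\<lambda>v. c x *s frechet_derivative \<psi> (at x) v + c' v *s \<psi> x)"
    by (rule has_derivative_unique[OF d\<phi>])
  then have D: "frechet_derivative \<phi> (at x) v =
      c x *s frechet_derivative \<psi> (at x) v + c' v *s \<psi> x" for v
    by (rule fun_cong)
  have cx: "\<phi> x = c x *s \<psi> x" "cmod (c x) = 1"
    using c[of x] U(2) V(2) by blast+
  have cc: "c x * cnj (c x) = 1"
    using complex_norm_square[of "c x"] cx(2) by simp
  have "herm (\<psi> x) (\<psi> x) = 1"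
    using V(2,4) by (auto simp: herm_self)
  then have "hor_part (c x *s \<psi> x) (c x *s w + d *s \<psi> x) = c x *s hor_part (\<psi> x) w" for w d
  proof -
    assume one: "herm (\<psi> x) (\<psi> x) = 1"
    have "herm (c x *s w + d *s \<psi> x) (c x *s \<psi> x) * c x =
        (c x * cnj (c x)) * (c x * herm w (\<psi> x) + d)"
      using one by (simp add: herm_algebra algebra_simps)
    also have "\<dots> = c x * herm w (\<psi> x) + d"
      using cc by simp
    finally have "herm (c x *s w + d *s \<psi> x) (c x *s \<psi> x) * c x = c x * herm w (\<psi> x) + d" .
    then show ?thesis
      by (simp add: hor_part_def vec_eq_iff algebra_simps)
  qed
  then have "hor_lift \<phi> x v = c x *s hor_lift \<psi> x v" for v
    by (simp only: hor_lift_def D cx(1))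
  with cx(2) show ?thesis by (rule that)
qed

lemma tangent_lift_eq:
  assumes "local_lift f x \<psi>"
  obtains c where "cmod c = 1" "\<And>v. tangent_lift f x v = c *s hor_lift \<psi> x v"
  unfolding tangent_lift_def
  using local_lift_unique[OF someI[of "local_lift f x", OF assms] assms] by blast

lemma fs_herm_eq:
  assumes "local_lift f x \<psi>"
  shows "fs_herm f x v w = herm (hor_lift \<psi> x v) (hor_lift \<psi> x w)"
proof -
  obtain c where c: "cmod c = 1" "\<And>v. tangent_lift f x v = c *s hor_lift \<psi> x v"
    using tangent_lift_eq[OF assms] by blast
  have "c * cnj c = 1"
    using complex_norm_square[of c] c(1) by simp
  then show ?thesis
    by (simp add: fs_herm_def c(2) herm_algebra mult.commute mult.left_commute)
qed


section \<open>Lagrangian, conformally flat and Hamiltonian-minimal immersions of \<open>\<real>\<^sup>3\<close>\<close>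

definition immersion_to_CP3 :: "(real^3 \<Rightarrow> (complex^4) set) \<Rightarrow> bool" where
  "immersion_to_CP3 f \<longleftrightarrow> smooth_to_CP3 f UNIV \<and> (\<forall>x. inj (tangent_lift f x))"

definition Lagrangian_immersion :: "(real^3 \<Rightarrow> (complex^4) set) \<Rightarrow> bool" where
  "Lagrangian_immersion f \<longleftrightarrow> immersion_to_CP3 f \<and> (\<forall>x v w. fs_omega f x v w = 0)"

definition conformally_flat :: "(real^3 \<Rightarrow> (complex^4) set) \<Rightarrow> bool" where
  "conformally_flat f \<longleftrightarrow> (\<exists>\<rho>. \<forall>x. \<rho> x > 0 \<and> (\<forall>v w. fs_metric f x v w = \<rho> x * (v \<bullet> w)))"

text \<open>The Riemannian volume of \<open>K\<close> with respect to the metric induced by \<open>f\<close>.\<close>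

definition volume_on :: "(real^3 \<Rightarrow> (complex^4) set) \<Rightarrow> (real^3) set \<Rightarrow> real" where
  "volume_on f K =
     integral K (\<lambda>x. sqrt (det (\<chi> i j. fs_metric f x (axis i 1) (axis j 1) :: real^3^3)))"

text \<open>
  A Hamiltonian deformation of \<open>f\<close>, stationary outside the compact set \<open>K\<close>: a smooth family of
  Lagrangian immersions \<open>F t\<close> starting at \<open>f\<close> such that, at each time, the 1-form
  \<open>\<omega>(\<partial>F/\<partial>t, d(F t)(\<cdot>))\<close> on \<open>\<real>\<^sup>3\<close> is exact.
\<close>

definition Hamiltonian_deformation ::
    "(real^3 \<Rightarrow> (complex^4) set) \<Rightarrow> (real^3) set \<Rightarrow> real \<Rightarrow> (real \<Rightarrow> real^3 \<Rightarrow> (complex^4) set) \<Rightarrow> bool" where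
  "Hamiltonian_deformation f K \<epsilon> F \<longleftrightarrow>
     smooth_to_CP3 (\<lambda>(t, x). F t x) ({-\<epsilon><..<\<epsilon>} \<times> UNIV) \<and>
     F 0 = f \<and>
     (\<forall>t\<in>{-\<epsilon><..<\<epsilon>}. Lagrangian_immersion (F t)) \<and>
     (\<forall>t\<in>{-\<epsilon><..<\<epsilon>}. \<forall>x. x \<notin> K \<longrightarrow> F t x = f x) \<and>
     (\<forall>t\<in>{-\<epsilon><..<\<epsilon>}. \<exists>h. smooth_on h UNIV \<and>
        (\<forall>x v. fs_omega (\<lambda>(t, x). F t x) (t, x) (1, 0) (0, v) =
               (frechet_derivative h (at x) v :: real)))"

text \<open>
  The total volume may be infinite, so criticality refers to the volume of the compact set outside
  of which the deformation is stationary.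
\<close>

definition H_minimal :: "(real^3 \<Rightarrow> (complex^4) set) \<Rightarrow> bool" where
  "H_minimal f \<longleftrightarrow>
     (\<forall>K \<epsilon> F. compact K \<and> \<epsilon> > 0 \<and> Hamiltonian_deformation f K \<epsilon> F \<longrightarrow>
        ((\<lambda>t. volume_on (F t) K) has_real_derivative 0) (at 0))"

end

theory Submission
  imports Defs
begin

text \<open>
  Writing \<open>w\<^sub>j = \<gamma>\<^sub>j\<^sup>2\<close>, Lagrange interpolation at the roots shows that \<open>(1, \<dots>, 1)\<close>, \<open>\<alpha>\<close> and \<open>\<beta>\<close> are
  orthogonal for the weights \<open>w\<close>, with squared norms \<open>1/\<CC>\<close>, \<open>1\<close> and \<open>1\<close>. Hence \<open>\<psi>\<close> is a horizontal lift
  of norm one whose partial derivatives are Hermitian-orthogonal of norm \<open>\<sigma> = exp u\<close>, so \<open>hopf \<circ> \<psi>\<close> is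
  Lagrangian and conformally flat.

  For a deformation, choose local lifts extending \<open>\<psi>\<close> and let \<open>V\<close> be their velocity. As the metric is
  \<open>\<sigma>\<^sup>2 |dx|\<^sup>2\<close>, the volume density varies by \<open>Re \<Sum>\<^sub>k \<langle>\<partial>\<^sub>k V, \<sigma> \<partial>\<^sub>k \<psi>\<rangle>\<close>. Moving \<open>\<partial>\<^sub>k\<close> to the other factor leaves
  a divergence and \<open>- Re \<langle>V, \<Sum>\<^sub>k \<partial>\<^sub>k (\<sigma> \<partial>\<^sub>k \<psi>)\<rangle>\<close>. The ordinary differential equation gives
  \<open>\<Sum>\<^sub>k \<partial>\<^sub>k (\<sigma> \<partial>\<^sub>k \<psi>) = - \<kappa> \<psi> + \<i> \<Sum>\<^sub>k n\<^sub>k \<partial>\<^sub>k \<psi>\<close> with real \<open>n\<^sub>k\<close> independent of \<open>x\<^sub>k\<close>. If the deformation is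
  Hamiltonian with function \<open>h\<close>, then \<open>Im \<langle>V, \<partial>\<^sub>k \<psi>\<rangle> = \<partial>\<^sub>k h\<close>, so this term is \<open>- \<Sum>\<^sub>k \<partial>\<^sub>k (n\<^sub>k (h - c))\<close>, again a
  divergence. For \<open>c\<close> the value of \<open>h\<close> near infinity both are compactly supported and integrate to zero.
\<close>

section \<open>Smooth maps\<close>

lemma frechet_derivative_at_eq:
  assumes "(f has_derivative f') (at x)"
  shows "frechet_derivative f (at x) = f'"
  using frechet_derivative_at[OF assms] by simp

lemma frechet_derivative_cong_open:
  assumes "open S" "x \<in> S" "\<And>y. y \<in> S \<Longrightarrow> f y = g y" "f differentiable (at x)"
  shows "frechet_derivative g (at x) = frechet_derivative f (at x)"
  using assms frechet_derivative_at_eq has_derivative_transform_within_open frechet_derivative_works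
  by metis

lemma Ck_on_continuous_on: "Ck_on k f S \<Longrightarrow> continuous_on S f"
  by (cases k)
     (auto intro!: continuous_at_imp_continuous_on differentiable_imp_continuous_within)

lemma Ck_on_SucD: "Ck_on (Suc k) f S \<Longrightarrow> Ck_on k f S"
proof (induction k arbitrary: f)
  case 0
  then show ?case using Ck_on_continuous_on[of "Suc 0" f S] by simp
next
  case (Suc k)
  have "\<forall>v. Ck_on (Suc k) (\<lambda>x. frechet_derivative f (at x) v) S"
    using Suc.prems by (metis Ck_on.simps(2))
  with Suc show ?case by (metis Ck_on.simps(2))
qed

text \<open>Openness of \<open>S\<close> lets an equality on \<open>S\<close> pass to the Frechet
  derivatives, which are taken in the whole space, and hence through the recursion.\<close>

lemma Ck_on_cong:
  assumes "open S" "\<And>x. x \<in> S \<Longrightarrow> f x = g x" "Ck_on k f S"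
  shows "Ck_on k g S"
  using assms(2,3)
proof (induction k arbitrary: f g)
  case 0
  then show ?case using continuous_on_cong[of S S f g] by simp
next
  case (Suc k)
  have "frechet_derivative g (at x) = frechet_derivative f (at x) \<and> g differentiable (at x)"
    if "x \<in> S" for x
  proof -
    have "(f has_derivative frechet_derivative f (at x)) (at x)"
      using Suc.prems that by (simp add: frechet_derivative_works)
    then have "(g has_derivative frechet_derivative f (at x)) (at x)"
      using has_derivative_transform_within_open[OF _ \<open>open S\<close> that] Suc.prems(1) by blast
    then show ?thesis
      using frechet_derivative_at_eq by (auto simp: differentiable_def)
  qed
  moreover have "Ck_on k (\<lambda>x. frechet_derivative g (at x) v) S" for v
    by (rule Suc.IH[of "\<lambda>x. frechet_derivative f (at x) v"]) (use calculation Suc.prems in auto)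
  ultimately show ?case by simp
qed

text \<open>Lets each closure property below exhibit an explicit derivative and run the induction on
  that formula instead of on \<open>frechet_derivative\<close>.\<close>

lemma Ck_onI:
  assumes "open S" "\<And>x. x \<in> S \<Longrightarrow> (f has_derivative f' x) (at x)"
    and "\<And>v. Ck_on k (\<lambda>x. f' x v) S"
  shows "Ck_on (Suc k) f S"
proof -
  have "Ck_on k (\<lambda>x. frechet_derivative f (at x) v) S" for v
    by (rule Ck_on_cong[OF assms(1) _ assms(3)[of v]])
      (use assms(2) frechet_derivative_at_eq in metis)
  then show ?thesis
    using assms(2) by (auto simp: differentiable_def)
qed

lemma Ck_on_has_derivative:
  "Ck_on (Suc k) f S \<Longrightarrow> x \<in> S \<Longrightarrow> (f has_derivative frechet_derivative f (at x)) (at x)"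
  by (simp add: frechet_derivative_works)

lemma Ck_on_subset: "Ck_on k f S \<Longrightarrow> T \<subseteq> S \<Longrightarrow> Ck_on k f T"
  by (induction k arbitrary: f) (auto intro: continuous_on_subset)

lemma Ck_on_const: "Ck_on k (\<lambda>x. c) S"
proof (induction k arbitrary: c)
  case (Suc k)
  have "frechet_derivative (\<lambda>x::'a. c) (at x) = (\<lambda>v. 0)" for x
    by (rule frechet_derivative_at_eq) (rule has_derivative_const)
  with Suc show ?case by simp
qed simp

lemma Ck_on_linear_compose:
  assumes "open S" "bounded_linear L" "Ck_on k f S"
  shows "Ck_on k (\<lambda>x. L (f x)) S"
  using assms(3)
proof (induction k arbitrary: f)
  case 0
  then show ?case using bounded_linear.continuous_on[OF assms(2)] by simp
next
  case (Suc k)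
  show ?case
  proof (rule Ck_onI[OF \<open>open S\<close>])
    show "((\<lambda>x. L (f x)) has_derivative (\<lambda>v. L (frechet_derivative f (at x) v))) (at x)"
      if "x \<in> S" for x
      using bounded_linear.has_derivative[OF assms(2) Ck_on_has_derivative[OF Suc.prems that]] .
  qed (use Suc in auto)
qed

lemma Ck_on_add:
  assumes "open S" "Ck_on k f S" "Ck_on k g S"
  shows "Ck_on k (\<lambda>x. f x + g x) S"
  using assms(2,3)
proof (induction k arbitrary: f g)
  case 0
  then show ?case by (simp add: continuous_on_add)
next
  case (Suc k)
  show ?case
  proof (rule Ck_onI[OF \<open>open S\<close>])
    show "((\<lambda>x. f x + g x) has_derivative
        (\<lambda>v. frechet_derivative f (at x) v + frechet_derivative g (at x) v)) (at x)"
      if "x \<in> S" for x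
      using has_derivative_add[OF Ck_on_has_derivative Ck_on_has_derivative] Suc.prems that by blast
  qed (use Suc in auto)
qed

text \<open>By the product rule the derivative is a sum of two expressions of the same shape, so the
  induction hypothesis applies once the undifferentiated factor is lowered to order
  \<open>k\<close>. One proof covers products, scalar multiples and \<open>herm\<close>.\<close>

lemma Ck_on_bilinear:
  assumes "open S" "bounded_bilinear B" "Ck_on k f S" "Ck_on k g S"
  shows "Ck_on k (\<lambda>x. B (f x) (g x)) S"
  using assms(3,4)
proof (induction k arbitrary: f g)
  case 0
  then show ?case using bounded_bilinear.continuous_on[OF assms(2)] by simp
next
  case (Suc k)
  show ?case
  proof (rule Ck_onI[OF \<open>open S\<close>])
    show "((\<lambda>x. B (f x) (g x)) has_derivative (\<lambda>v. B (f x) (frechet_derivative g (at x) v) +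
        B (frechet_derivative f (at x) v) (g x))) (at x)"
      if "x \<in> S" for x
      using bounded_bilinear.FDERIV[OF assms(2) Ck_on_has_derivative Ck_on_has_derivative]
        Suc.prems that by blast
    show "Ck_on k (\<lambda>x. B (f x) (frechet_derivative g (at x) v) +
        B (frechet_derivative f (at x) v) (g x)) S" for v
      using Suc.prems Ck_on_SucD[OF Suc.prems(1)] Ck_on_SucD[OF Suc.prems(2)]
      by (intro Ck_on_add \<open>open S\<close> Suc.IH) auto
  qed
qed

lemma Ck_on_compose_affine:
  assumes "open S" "bounded_linear L" "Ck_on k f S"
  shows "Ck_on k (\<lambda>x. f (c + L x)) ((\<lambda>x. c + L x) -` S)"
  using assms(3)
proof (induction k arbitrary: f)
  case 0
  have "continuous_on ((\<lambda>x. c + L x) -` S) (\<lambda>x. c + L x)"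
    by (intro continuous_intros linear_continuous_on assms)
  with 0 show ?case
    by (auto intro: continuous_on_compose2)
next
  case (Suc k)
  have op: "open ((\<lambda>x. c + L x) -` S)"
    by (intro open_vimage assms continuous_intros linear_continuous_on)
  show ?case
  proof (rule Ck_onI[OF op])
    show "((\<lambda>x. f (c + L x)) has_derivative (\<lambda>v. frechet_derivative f (at (c + L x)) (L v))) (at x)"
      if "x \<in> (\<lambda>x. c + L x) -` S" for x
    proof -
      have "((\<lambda>x. c + L x) has_derivative L) (at x)"
        by (auto intro!: derivative_eq_intros bounded_linear_imp_has_derivative assms)
      moreover have "(f has_derivative frechet_derivative f (at (c + L x))) (at (c + L x))"
        using Ck_on_has_derivative[OF Suc.prems] that by simp
      ultimately show ?thesis
        using has_derivative_compose[of "\<lambda>x. c + L x" L x UNIV f] by simp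
    qed
    show "Ck_on k (\<lambda>x. frechet_derivative f (at (c + L x)) (L v)) ((\<lambda>x. c + L x) -` S)" for v
      by (rule Suc.IH) (use Suc.prems in simp)
  qed
qed

text \<open>Every layer of the recursion is a condition at points. This is what gives smoothness of
  quantities built from lifts, which exist only locally.\<close>

lemma Ck_on_local:
  assumes "\<And>x. x \<in> S \<Longrightarrow> \<exists>U. open U \<and> x \<in> U \<and> Ck_on k f U"
  shows "Ck_on k f S"
  using assms
proof (induction k arbitrary: f)
  case 0
  then show ?case
    by (metis Ck_on.simps(1) continuous_at_imp_continuous_on continuous_on_eq_continuous_at)
next
  case (Suc k)
  show ?case
    using Suc.prems Suc.IH by (metis Ck_on.simps(2))
qed

lemma smooth_on_Ck: "smooth_on f S \<Longrightarrow> Ck_on k f S"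
  by (simp add: smooth_on_def)

lemma smooth_on_continuous_on: "smooth_on f S \<Longrightarrow> continuous_on S f"
  using smooth_on_Ck Ck_on_continuous_on by blast

lemma smooth_on_has_derivative:
  "smooth_on f S \<Longrightarrow> x \<in> S \<Longrightarrow> (f has_derivative frechet_derivative f (at x)) (at x)"
  using smooth_on_Ck Ck_on_has_derivative by blast

lemma smooth_on_differentiable: "smooth_on f S \<Longrightarrow> x \<in> S \<Longrightarrow> f differentiable (at x)"
  using smooth_on_has_derivative by (auto simp: differentiable_def)

lemma smooth_on_derivative:
  "smooth_on f S \<Longrightarrow> smooth_on (\<lambda>x. frechet_derivative f (at x) v) S"
  unfolding smooth_on_def by (metis Ck_on.simps(2))

lemma smooth_on_cong:
  "open S \<Longrightarrow> (\<And>x. x \<in> S \<Longrightarrow> f x = g x) \<Longrightarrow> smooth_on f S \<Longrightarrow> smooth_on g S"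
  unfolding smooth_on_def using Ck_on_cong by blast

lemma smooth_on_subset: "smooth_on f S \<Longrightarrow> T \<subseteq> S \<Longrightarrow> smooth_on f T"
  unfolding smooth_on_def using Ck_on_subset by blast

lemma smooth_on_const: "smooth_on (\<lambda>x. c) S"
  by (simp add: smooth_on_def Ck_on_const)

lemma smooth_on_linear_compose:
  "open S \<Longrightarrow> bounded_linear L \<Longrightarrow> smooth_on f S \<Longrightarrow> smooth_on (\<lambda>x. L (f x)) S"
  by (simp add: smooth_on_def Ck_on_linear_compose)

lemma smooth_on_add:
  "open S \<Longrightarrow> smooth_on f S \<Longrightarrow> smooth_on g S \<Longrightarrow> smooth_on (\<lambda>x. f x + g x) S"
  by (simp add: smooth_on_def Ck_on_add)

lemma smooth_on_bilinear:
  "open S \<Longrightarrow> bounded_bilinear B \<Longrightarrow> smooth_on f S \<Longrightarrow> smooth_on g S \<Longrightarrow>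
    smooth_on (\<lambda>x. B (f x) (g x)) S"
  by (simp add: smooth_on_def Ck_on_bilinear)

lemma smooth_on_mult:
  fixes f g :: "'a::real_normed_vector \<Rightarrow> 'b::real_normed_algebra"
  shows "open S \<Longrightarrow> smooth_on f S \<Longrightarrow> smooth_on g S \<Longrightarrow> smooth_on (\<lambda>x. f x * g x) S"
  by (rule smooth_on_bilinear[OF _ bounded_bilinear_mult])

lemma smooth_on_diff:
  "open S \<Longrightarrow> smooth_on f S \<Longrightarrow> smooth_on g S \<Longrightarrow> smooth_on (\<lambda>x. f x - g x) S"
  using smooth_on_add[of S f "\<lambda>x. - g x"]
    smooth_on_linear_compose[OF _ bounded_linear_minus[OF bounded_linear_ident], of S g] by simp

lemma smooth_on_sum:
  "open S \<Longrightarrow> (\<And>i. i \<in> I \<Longrightarrow> smooth_on (f i) S) \<Longrightarrow> smooth_on (\<lambda>x. \<Sum>i\<in>I. f i x) S"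
  by (induction I rule: infinite_finite_induct) (auto intro: smooth_on_const smooth_on_add)

lemma smooth_on_compose_affine:
  "open S \<Longrightarrow> bounded_linear L \<Longrightarrow> smooth_on f S \<Longrightarrow>
    smooth_on (\<lambda>x. f (c + L x)) ((\<lambda>x. c + L x) -` S)"
  by (simp add: smooth_on_def Ck_on_compose_affine)

lemma smooth_on_compose_linear:
  "open S \<Longrightarrow> bounded_linear L \<Longrightarrow> smooth_on f S \<Longrightarrow> smooth_on (\<lambda>x. f (L x)) (L -` S)"
  using smooth_on_compose_affine[of S L f 0] by simp

lemma smooth_on_local:
  "(\<And>x. x \<in> S \<Longrightarrow> \<exists>U. open U \<and> x \<in> U \<and> smooth_on f U) \<Longrightarrow> smooth_on f S"
  unfolding smooth_on_def using Ck_on_local by metis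

lemma smooth_on_vec:
  fixes f :: "'a::real_normed_vector \<Rightarrow> complex^'n"
  assumes "open S" "\<And>i. smooth_on (\<lambda>x. f x $ i) S"
  shows "smooth_on f S"
proof -
  have "bounded_linear (axis i :: complex \<Rightarrow> complex^'n)" for i
    by (auto intro!: linear_conv_bounded_linear[THEN iffD1] linearI simp: vec_eq_iff axis_def)
  then have "smooth_on (\<lambda>x. \<Sum>i\<in>UNIV. axis i (f x $ i)) S"
    using assms by (intro smooth_on_sum smooth_on_linear_compose[where L = "axis _"]) auto
  moreover have "(\<lambda>x. \<Sum>i\<in>UNIV. axis i (f x $ i)) = f"
    by (simp add: fun_eq_iff vec_eq_iff axis_def)
  ultimately show ?thesis by simp
qed

text \<open>Covers exponentials: each derivative of \<open>f\<close> is a smooth multiple of \<open>f\<close>.\<close>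

lemma smooth_on_log_derivative:
  fixes f :: "'a::real_normed_vector \<Rightarrow> 'b::real_normed_algebra"
  assumes "open S" "\<And>x. x \<in> S \<Longrightarrow> (f has_derivative (\<lambda>v. l x v * f x)) (at x)"
    and "\<And>v. smooth_on (\<lambda>x. l x v) S"
  shows "smooth_on f S"
  unfolding smooth_on_def
proof
  show "Ck_on k f S" for k
  proof (induction k)
    case 0
    have "f differentiable (at x)" if "x \<in> S" for x
      using assms(2)[OF that] unfolding differentiable_def by blast
    then show ?case
      by (auto intro!: continuous_at_imp_continuous_on differentiable_imp_continuous_within)
  next
    case (Suc k)
    have "Ck_on k (\<lambda>x. l x v) S" for v
      using assms(3) by (simp add: smooth_on_def)
    then show ?case
      by (intro Ck_onI[OF assms(1,2)] Ck_on_bilinear[OF assms(1) bounded_bilinear_mult] Suc)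
  qed
qed

text \<open>The derivative is a product of a derivative of \<open>f\<close> with copies of
  \<open>inverse (f x)\<close>, so order \<open>k\<close> for the inverse yields order
  \<open>k + 1\<close>.\<close>

lemma smooth_on_inverse:
  fixes f :: "'a::real_normed_vector \<Rightarrow> real"
  assumes "open S" "smooth_on f S" "\<And>x. x \<in> S \<Longrightarrow> f x \<noteq> 0"
  shows "smooth_on (\<lambda>x. inverse (f x)) S"
  unfolding smooth_on_def
proof
  let ?f' = "\<lambda>x v. - (inverse (f x) * frechet_derivative f (at x) v * inverse (f x))"
  show "Ck_on k (\<lambda>x. inverse (f x)) S" for k
  proof (induction k)
    case 0
    then show ?case
      using assms(3) smooth_on_continuous_on[OF assms(2)] by (auto intro!: continuous_intros)
  next
    case (Suc k)
    show ?case
    proof (rule Ck_onI[OF assms(1), where f' = ?f'])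
      show "((\<lambda>x. inverse (f x)) has_derivative ?f' x) (at x)" if "x \<in> S" for x
        using assms(3) smooth_on_has_derivative[OF assms(2)] that by (intro Deriv.has_derivative_inverse) auto
      show "Ck_on k (\<lambda>x. ?f' x v) S" for v
        by (intro Ck_on_linear_compose[OF assms(1) bounded_linear_minus[OF bounded_linear_ident]]
            Ck_on_bilinear[OF assms(1) bounded_bilinear_mult] Suc
            smooth_on_Ck[OF smooth_on_derivative[OF assms(2)]])
    qed
  qed
qed

text \<open>Both mixed derivatives are limits of the same second difference quotient.\<close>

lemma frechet_derivative_commute_real:
  fixes f :: "'a::real_normed_vector \<Rightarrow> real"
  assumes "open S" "x \<in> S" "smooth_on f S"
  shows "frechet_derivative (\<lambda>y. frechet_derivative f (at y) u) (at x) v =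
         frechet_derivative (\<lambda>y. frechet_derivative f (at y) v) (at x) u"
proof -
  define D where "D g w y = frechet_derivative g (at y) w" for g :: "'a \<Rightarrow> real" and w y
  obtain r where r: "r > 0" "ball x r \<subseteq> S"
    using assms openE by blast
  have D_smooth: "smooth_on (D g w) S" if "smooth_on g S" for g w
    unfolding D_def using smooth_on_derivative[OF that] .
  have line: "((\<lambda>s. g (y + s *\<^sub>R w)) has_real_derivative D g w (y + s *\<^sub>R w)) (at s)"
    if "smooth_on g S" "y + s *\<^sub>R w \<in> S" for g y s w
  proof -
    have "((\<lambda>s. y + s *\<^sub>R w) has_derivative (\<lambda>h. h *\<^sub>R w)) (at s)"
      by (auto intro!: derivative_eq_intros)
    then have "((\<lambda>s. g (y + s *\<^sub>R w)) has_derivative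
        (\<lambda>h. frechet_derivative g (at (y + s *\<^sub>R w)) (h *\<^sub>R w))) (at s)"
      using has_derivative_compose smooth_on_has_derivative[OF that] by blast
    moreover have "frechet_derivative g (at (y + s *\<^sub>R w)) (h *\<^sub>R w) = D g w (y + s *\<^sub>R w) * h" for h
      using linear_cmul[OF has_derivative_linear[OF smooth_on_has_derivative[OF that]]]
      by (simp add: D_def mult.commute)
    ultimately show ?thesis
      by (simp add: has_field_derivative_def)
  qed
  \<comment> \<open>The second difference over the parallelogram spanned by
    \<open>h *\<^sub>R u\<close> and \<open>h *\<^sub>R v\<close>; it is symmetric in
    \<open>u\<close> and \<open>v\<close>.\<close>
  define d where "d h u v = f (x + h *\<^sub>R u + h *\<^sub>R v) - f (x + h *\<^sub>R v) - (f (x + h *\<^sub>R u) - f x)" for h u v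
  have quot: "\<exists>y. dist x y \<le> h * (norm u + norm v) \<and> d h u v = h\<^sup>2 * D (D f u) v y"
    if h: "h > 0" "h * (norm u + norm v) < r" for h u v
  proof -
    have inS: "x + s *\<^sub>R u + t *\<^sub>R v \<in> S \<and> dist x (x + s *\<^sub>R u + t *\<^sub>R v) \<le> h * (norm u + norm v)"
      if "0 \<le> s" "s \<le> h" "0 \<le> t" "t \<le> h" for s t
    proof -
      have "norm (s *\<^sub>R u + t *\<^sub>R v) \<le> h * norm u + h * norm v"
        using that by (intro norm_triangle_mono) (auto intro!: mult_right_mono)
      then have "dist x (x + s *\<^sub>R u + t *\<^sub>R v) \<le> h * (norm u + norm v)"
        by (metis add.assoc add_diff_cancel_left' dist_commute dist_norm distrib_left)
      then show ?thesis using r h by auto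
    qed
    \<comment> \<open>Mean value theorem in the direction \<open>u\<close> for the difference of
      \<open>f\<close> along two opposite edges. A second application in the direction
      \<open>v\<close> then produces the mixed derivative.\<close>
    have "\<exists>s. 0 < s \<and> s < h \<and> (f (x + h *\<^sub>R v + h *\<^sub>R u) - f (x + h *\<^sub>R u)) - (f (x + h *\<^sub>R v + 0 *\<^sub>R u) - f (x + 0 *\<^sub>R u))
        = (h - 0) * (D f u (x + h *\<^sub>R v + s *\<^sub>R u) - D f u (x + s *\<^sub>R u))"
      using inS[of _ h] inS[of _ 0] h(1)
      by (intro MVT2 DERIV_diff line assms) (auto simp: add.commute add.left_commute)
    then obtain s where s: "0 < s" "s < h"
      "d h u v = h * (D f u (x + s *\<^sub>R u + h *\<^sub>R v) - D f u (x + s *\<^sub>R u + 0 *\<^sub>R v))"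
      by (auto simp: d_def algebra_simps)
    have "\<exists>t. 0 < t \<and> t < h \<and> D f u (x + s *\<^sub>R u + h *\<^sub>R v) - D f u (x + s *\<^sub>R u + 0 *\<^sub>R v) =
        (h - 0) * D (D f u) v (x + s *\<^sub>R u + t *\<^sub>R v)"
      using inS[of s] h(1) s by (intro MVT2 line D_smooth assms) auto
    then obtain t where "0 < t" "t < h" "d h u v = h\<^sup>2 * D (D f u) v (x + s *\<^sub>R u + t *\<^sub>R v)"
      using s by (auto simp: power2_eq_square)
    with inS[of s t] s show ?thesis by auto
  qed
  \<comment> \<open>The summand 1 keeps \<open>M\<close> positive even when \<open>u\<close> and
    \<open>v\<close> are zero; step sizes of at most \<open>r / M\<close> keep every parallelogram
    inside the ball.\<close>
  define M where "M = norm u + norm v + 1"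
  have M: "M > 0" by (simp add: M_def add_nonneg_pos)
  define hs where "hs n = r / M * inverse (real (Suc n))" for n :: nat
  have hs: "hs n > 0" "hs n * (norm u + norm v) < r" for n
  proof -
    show "hs n > 0" using r M by (simp add: hs_def)
    have "hs n \<le> r / M"
      using r M by (simp add: hs_def divide_simps)
    then have "hs n * (norm u + norm v) \<le> r / M * (norm u + norm v)"
      by (intro mult_right_mono) auto
    also have "\<dots> < r / M * M"
      using r M by (intro mult_strict_left_mono) (auto simp: M_def)
    finally show "hs n * (norm u + norm v) < r" using M by simp
  qed
  have hs0: "(\<lambda>n. hs n * (norm u + norm v)) \<longlonglongrightarrow> 0"
    unfolding hs_def
    by (intro tendsto_mult_left_zero tendsto_mult_right_zero LIMSEQ_inverse_real_of_nat)
  obtain p where p: "\<And>n. dist x (p n) \<le> hs n * (norm u + norm v)"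
      "\<And>n. d (hs n) u v = (hs n)\<^sup>2 * D (D f u) v (p n)"
    using quot[OF hs] by metis
  have hs': "hs n * (norm v + norm u) < r" for n
    using hs by (simp add: add.commute)
  obtain q where q: "\<And>n. dist x (q n) \<le> hs n * (norm v + norm u)"
      "\<And>n. d (hs n) v u = (hs n)\<^sup>2 * D (D f v) u (q n)"
    using quot[OF hs(1) hs'] by metis
  have lim: "(\<lambda>n. D (D f a) b (w n)) \<longlonglongrightarrow> D (D f a) b x"
    if "\<And>n. dist x (w n) \<le> hs n * (norm u + norm v)" for w a b
  proof -
    have "(\<lambda>n. dist (w n) x) \<longlonglongrightarrow> 0"
      by (rule tendsto_sandwich[OF _ _ tendsto_const hs0]) (use that in \<open>auto simp: dist_commute\<close>)
    then have "w \<longlonglongrightarrow> x" by (rule tendsto_dist_iff[THEN iffD2])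
    moreover have "isCont (D (D f a) b) x"
      using smooth_on_continuous_on[OF D_smooth[OF D_smooth[OF assms(3)]]] assms
      by (simp add: continuous_on_eq_continuous_at)
    ultimately show ?thesis by (rule isCont_tendsto_compose[rotated])
  qed
  \<comment> \<open>Cancelling the square of the step size equates the two mixed derivatives at
    points that both tend to \<open>x\<close>.\<close>
  have "d h v u = d h u v" for h by (simp add: d_def algebra_simps)
  then have "D (D f u) v (p n) = D (D f v) u (q n)" for n
    using p(2) q(2) hs(1)[of n] by (metis less_irrefl mult_left_cancel zero_less_power)
  moreover have "(\<lambda>n. D (D f u) v (p n)) \<longlonglongrightarrow> D (D f u) v x"
    using lim p by blast
  moreover have "(\<lambda>n. D (D f v) u (q n)) \<longlonglongrightarrow> D (D f v) u x"
    using lim q(1) by (simp add: add.commute)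
  ultimately have "D (D f u) v x = D (D f v) u x"
    by (simp add: LIMSEQ_unique)
  then show ?thesis by (simp add: D_def[abs_def])
qed

lemma frechet_derivative_linear_compose:
  assumes "bounded_linear L" "f differentiable (at x)"
  shows "frechet_derivative (\<lambda>y. L (f y)) (at x) v = L (frechet_derivative f (at x) v)"
  using frechet_derivative_at_eq[OF bounded_linear.has_derivative[OF assms(1)]] assms(2)
  by (metis frechet_derivative_works)

text \<open>Taking the inner product with an arbitrary \<open>w\<close> reduces this to the
  real-valued case, as a vector is determined by its inner products.\<close>

lemma frechet_derivative_commute:
  fixes f :: "'a::real_normed_vector \<Rightarrow> 'b::real_inner"
  assumes "open S" "x \<in> S" "smooth_on f S"
  shows "frechet_derivative (\<lambda>y. frechet_derivative f (at y) u) (at x) v =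
         frechet_derivative (\<lambda>y. frechet_derivative f (at y) v) (at x) u"
proof -
  have sm: "smooth_on (\<lambda>y. f y \<bullet> w) S" for w
    using smooth_on_linear_compose[OF assms(1) bounded_linear_inner_left assms(3)] .
  have swap: "frechet_derivative (\<lambda>y. frechet_derivative (\<lambda>y. f y \<bullet> w) (at y) u) (at x) v =
      frechet_derivative (\<lambda>y. frechet_derivative f (at y) u) (at x) v \<bullet> w" for u v w
  proof -
    have "frechet_derivative (\<lambda>y. f y \<bullet> w) (at y) u = frechet_derivative f (at y) u \<bullet> w"
      if "y \<in> S" for y
      by (rule frechet_derivative_linear_compose[OF bounded_linear_inner_left
            smooth_on_differentiable[OF assms(3) that]])
    then have "frechet_derivative (\<lambda>y. frechet_derivative f (at y) u \<bullet> w) (at x) =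
        frechet_derivative (\<lambda>y. frechet_derivative (\<lambda>y. f y \<bullet> w) (at y) u) (at x)"
      using smooth_on_differentiable[OF smooth_on_derivative[OF sm] assms(2)]
      by (rule frechet_derivative_cong_open[OF assms(1,2)])
    then show ?thesis
      using frechet_derivative_linear_compose[OF bounded_linear_inner_left
          smooth_on_differentiable[OF smooth_on_derivative[OF assms(3)] assms(2)]] by metis
  qed
  from frechet_derivative_commute_real[OF assms(1,2) sm] show ?thesis
    unfolding swap by (metis vector_eq_rdot)
qed

section \<open>Integrals of directional derivatives\<close>

lemma integral_superset_zero:
  fixes f :: "'a::euclidean_space \<Rightarrow> 'b::euclidean_space"
  assumes "S \<subseteq> T" "\<And>x. x \<in> T - S \<Longrightarrow> f x = 0"
  shows "integral T f = integral S f"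
proof -
  have "(\<lambda>x. if x \<in> T then f x else 0) = (\<lambda>x. if x \<in> S then f x else 0)"
    using assms by (auto simp: fun_eq_iff)
  then show ?thesis
    using integral_restrict_UNIV[of T f] integral_restrict_UNIV[of S f] by simp
qed

text \<open>The integral over a large box is invariant under small translations of the compactly
  supported integrand; differentiate along the translation.\<close>

lemma integral_directional_derivative_zero:
  fixes G G' :: "'a::euclidean_space \<Rightarrow> real"
  assumes der: "\<And>p. ((\<lambda>s. G (p + s *\<^sub>R v)) has_real_derivative G' p) (at 0)"
    and cont: "continuous_on UNIV G" "continuous_on UNIV G'"
    and supp: "\<And>p. p \<notin> cbox a b \<Longrightarrow> G p = 0"
  shows "integral (cbox a b) G' = 0"
proof -
  obtain B where B: "B > 0" "\<forall>p\<in>cbox a b. norm p \<le> B"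
    using bounded_cbox[of a b] bounded_pos by blast
  \<comment> \<open>Enlarging by \<open>norm v\<close> on every side makes each translate of the big
    box by \<open>s *\<^sub>R v\<close> with \<open>\<bar>s\<bar> \<le> 1\<close> still contain the
    support.\<close>
  define c where "c = (\<Sum>i\<in>Basis. - (B + norm v) *\<^sub>R i :: 'a)"
  define d where "d = (\<Sum>i\<in>Basis. (B + norm v) *\<^sub>R i :: 'a)"
  have ci: "c \<bullet> i = - (B + norm v)" "d \<bullet> i = B + norm v" if "i \<in> Basis" for i
    unfolding c_def d_def using that by (simp_all only: inner_sum_left_Basis)
  have sub: "cbox a b \<subseteq> cbox (c + s *\<^sub>R v) (d + s *\<^sub>R v)" if "\<bar>s\<bar> \<le> 1" for s
  proof
    fix p assume p: "p \<in> cbox a b"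
    show "p \<in> cbox (c + s *\<^sub>R v) (d + s *\<^sub>R v)"
      unfolding mem_box
    proof
      fix i :: 'a assume i: "i \<in> Basis"
      have "\<bar>p \<bullet> i\<bar> \<le> B"
        using B(2) p Basis_le_norm[OF i, of p] by force
      moreover have "\<bar>s * (v \<bullet> i)\<bar> \<le> norm v"
        using Basis_le_norm[OF i, of v] mult_mono[OF that, of "\<bar>v \<bullet> i\<bar>" "norm v"]
        by (simp add: abs_mult)
      ultimately show "(c + s *\<^sub>R v) \<bullet> i \<le> p \<bullet> i \<and> p \<bullet> i \<le> (d + s *\<^sub>R v) \<bullet> i"
        using ci[OF i] by (auto simp: inner_add_left abs_le_iff)
    qed
  qed
  \<comment> \<open>The box is closed, so \<open>G\<close> vanishes on a whole neighbourhood of a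
    point outside it.\<close>
  have G': "G' p = 0" if "p \<notin> cbox a b" for p
  proof -
    have "((\<lambda>s. 0) has_real_derivative G' p) (at 0)"
    proof (rule DERIV_cong_ev[THEN iffD1, OF refl _ refl der])
      have "open ((\<lambda>s. p + s *\<^sub>R v) -` (- cbox a b))"
        by (intro open_vimage continuous_intros) auto
      then show "\<forall>\<^sub>F s in nhds 0. G (p + s *\<^sub>R v) = 0"
        unfolding eventually_nhds using that supp
        by (intro exI[of _ "(\<lambda>s. p + s *\<^sub>R v) -` (- cbox a b)"]) auto
    qed
    then show ?thesis using DERIV_unique DERIV_const by blast
  qed
  have shift: "integral (cbox c d) (\<lambda>p. G (p + s *\<^sub>R v)) = integral (cbox a b) G" if "\<bar>s\<bar> \<le> 1" for s
  proof -
    have "integral (cbox c d) (\<lambda>p. G (p + s *\<^sub>R v)) =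
        integral (cbox (c + s *\<^sub>R v) (d + s *\<^sub>R v)) G"
      using integral_shift_cbox_plus[of c d G "s *\<^sub>R v"] by (simp add: o_def add.commute)
    also have "\<dots> = integral (cbox a b) G"
      using supp by (intro integral_superset_zero sub that) auto
    finally show ?thesis .
  qed
  define U where "U = {-1<..<1::real}"
  have "((\<lambda>s. integral (cbox c d) (\<lambda>p. G (p + s *\<^sub>R v))) has_field_derivative
      integral (cbox c d) (\<lambda>p. G' (p + 0 *\<^sub>R v))) (at 0 within U)"
  proof (rule leibniz_rule_field_derivative)
    show "((\<lambda>s. G (p + s *\<^sub>R v)) has_real_derivative G' (p + s *\<^sub>R v)) (at s within U)" for s p
    proof -
      have "((\<lambda>t. G (p + s *\<^sub>R v + (t + - s) *\<^sub>R v)) has_real_derivative G' (p + s *\<^sub>R v)) (at s)"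
        by (rule DERIV_shift[THEN iffD1]) (use der[of "p + s *\<^sub>R v"] in simp)
      moreover have "p + s *\<^sub>R v + (t + - s) *\<^sub>R v = p + t *\<^sub>R v" for t
        by (simp add: scaleR_left_diff_distrib)
      ultimately show ?thesis
        by (simp only: has_field_derivative_at_within)
    qed
    show "(\<lambda>p. G (p + s *\<^sub>R v)) integrable_on cbox c d" for s
      by (intro integrable_continuous continuous_on_compose2[OF cont(1)] continuous_intros) auto
    show "continuous_on (U \<times> cbox c d) (\<lambda>(s, p). G' (p + s *\<^sub>R v))"
      unfolding split_def
      by (intro continuous_on_compose2[OF cont(2)] continuous_intros) auto
  qed (auto simp: U_def)
  moreover have "at 0 within U = at 0"
    by (rule at_within_open) (auto simp: U_def)
  ultimately have "((\<lambda>s. integral (cbox c d) (\<lambda>p. G (p + s *\<^sub>R v))) has_field_derivative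
      integral (cbox c d) G') (at 0)"
    by (simp only: scaleR_zero_left add_0_right)
  moreover have "((\<lambda>s. integral (cbox c d) (\<lambda>p. G (p + s *\<^sub>R v))) has_field_derivative 0) (at 0)"
    by (rule has_field_derivative_transform_within_open[OF DERIV_const, where S = U])
      (use shift in \<open>auto simp: U_def\<close>)
  ultimately have "integral (cbox c d) G' = 0"
    using DERIV_unique by blast
  moreover have "integral (cbox c d) G' = integral (cbox a b) G'"
    using G' sub[of 0] by (intro integral_superset_zero) auto
  ultimately show ?thesis by simp
qed

section \<open>Lifts of maps into \<open>\<complex>P\<^sup>3\<close>\<close>

lemma local_lift_cong:
  assumes "open U" "x \<in> U" "\<And>y. y \<in> U \<Longrightarrow> f y = g y" "local_lift f x \<psi>"
  shows "local_lift g x \<psi>"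
proof -
  from assms(4) obtain V where V: "open V" "x \<in> V" "smooth_on \<psi> V"
      "\<forall>y\<in>V. \<psi> y \<in> S7 \<and> hopf (\<psi> y) = f y"
    unfolding local_lift_def by blast
  have "open (U \<inter> V)" "x \<in> U \<inter> V" using V assms by auto
  moreover have "smooth_on \<psi> (U \<inter> V)" using smooth_on_subset[OF V(3)] by blast
  ultimately show ?thesis
    unfolding local_lift_def using V(4) assms(3) by (metis IntD1 IntD2)
qed

text \<open>Maps that agree near \<open>x\<close> have the same local lifts there, so the choice
  operator in \<open>tangent_lift\<close> returns the same lift for both.\<close>

lemma fs_herm_cong:
  assumes "open U" "x \<in> U" "\<And>y. y \<in> U \<Longrightarrow> f y = g y"
  shows "fs_herm f x = fs_herm g x"
proof -
  have "local_lift f x = local_lift g x"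
    using local_lift_cong[OF assms(1,2), of f g] local_lift_cong[OF assms(1,2), of g f] assms(3)
    by (intro ext iffI) auto
  then show ?thesis
    by (simp add: fun_eq_iff fs_herm_def tangent_lift_def)
qed

lemma herm_cnj: "herm u v = cnj (herm v u)"
  by (simp add: herm_def mult.commute)

lemma herm_hor_part:
  assumes "p \<in> S7"
  shows "herm (hor_part p v) (hor_part p w) = herm v w - herm v p * herm p w"
proof -
  have "herm p p = 1" using assms by (simp add: herm_self)
  then show ?thesis
    by (simp add: hor_part_def herm_algebra algebra_simps herm_cnj[of p w])
qed

text \<open>The subtracted product removes the vertical components. One lift serves all points of
  \<open>U\<close> at once, so the Hermitian form can be differentiated in \<open>p\<close>.\<close>

lemma fs_herm_local:
  assumes "open U" "smooth_on \<Psi> U" "\<And>p. p \<in> U \<Longrightarrow> \<Psi> p \<in> S7 \<and> hopf (\<Psi> p) = f p" "p \<in> U"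
  shows "fs_herm f p v w =
    herm (frechet_derivative \<Psi> (at p) v) (frechet_derivative \<Psi> (at p) w) -
    herm (frechet_derivative \<Psi> (at p) v) (\<Psi> p) * herm (\<Psi> p) (frechet_derivative \<Psi> (at p) w)"
proof -
  have "local_lift f p \<Psi>"
    unfolding local_lift_def using assms by blast
  then show ?thesis
    using assms(3,4) by (simp add: fs_herm_eq hor_lift_def herm_hor_part)
qed

lemma smooth_on_herm:
  "open S \<Longrightarrow> smooth_on f S \<Longrightarrow> smooth_on g S \<Longrightarrow> smooth_on (\<lambda>x. herm (f x) (g x)) S"
  by (rule smooth_on_bilinear[OF _ bounded_bilinear_herm])

lemma smooth_on_fs_herm:
  assumes "smooth_to_CP3 f S"
  shows "smooth_on (\<lambda>p. fs_herm f p v w) S"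
proof (rule smooth_on_local)
  fix x assume "x \<in> S"
  then obtain \<Psi> U where U: "open U" "x \<in> U" "smooth_on \<Psi> U"
      "\<And>p. p \<in> U \<Longrightarrow> \<Psi> p \<in> S7 \<and> hopf (\<Psi> p) = f p"
    using assms unfolding smooth_to_CP3_def local_lift_def by metis
  have "smooth_on (\<lambda>p. herm (frechet_derivative \<Psi> (at p) v) (frechet_derivative \<Psi> (at p) w) -
    herm (frechet_derivative \<Psi> (at p) v) (\<Psi> p) * herm (\<Psi> p) (frechet_derivative \<Psi> (at p) w)) U"
    using U by (intro smooth_on_diff smooth_on_mult smooth_on_herm smooth_on_derivative)
  then have "smooth_on (\<lambda>p. fs_herm f p v w) U"
    by (rule smooth_on_cong[OF U(1), rotated]) (use fs_herm_local U in metis)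
  with U show "\<exists>U. open U \<and> x \<in> U \<and> smooth_on (\<lambda>p. fs_herm f p v w) U"
    by blast
qed

lemma smooth_on_fs_metric:
  assumes "open S" "smooth_to_CP3 f S"
  shows "smooth_on (\<lambda>p. fs_metric f p v w) S"
  unfolding fs_metric_def
  by (rule smooth_on_linear_compose[OF assms(1) bounded_linear_Re smooth_on_fs_herm[OF assms(2)]])

section \<open>Restriction of a deformation to a fixed time\<close>

lemma vimage_Pair_slice: "(\<lambda>y. (t, 0) + (0, y)) -` U = {y. (t, y) \<in> U}"
  for t :: "'t::real_normed_vector" and U :: "('t \<times> 'a::real_normed_vector) set"
  by auto

lemma bounded_linear_Pair_zero: "bounded_linear (\<lambda>y. (0, y))"
  by (rule bounded_linear_Pair[OF bounded_linear_zero bounded_linear_ident])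

lemma open_slice:
  fixes U :: "('t::real_normed_vector \<times> 'a::real_normed_vector) set"
  assumes "open U"
  shows "open {y. (t, y) \<in> U}"
proof -
  have "open ((\<lambda>y. (t, y)) -` U)" by (intro open_vimage assms continuous_intros)
  then show ?thesis by (simp add: vimage_def)
qed

lemma smooth_on_slice:
  fixes \<Psi> :: "'t::real_normed_vector \<times> 'a::real_normed_vector \<Rightarrow> 'b::real_normed_vector"
  assumes "open U" "smooth_on \<Psi> U"
  shows "smooth_on (\<lambda>y. \<Psi> (t, y)) {y. (t, y) \<in> U}"
  using smooth_on_compose_affine[OF assms(1) bounded_linear_Pair_zero assms(2), of "(t, 0)"]
  unfolding vimage_Pair_slice by simp

lemma has_derivative_slice:
  assumes "\<Psi> differentiable (at (t, x))"
  shows "((\<lambda>y. \<Psi> (t, y)) has_derivative (\<lambda>v. frechet_derivative \<Psi> (at (t, x)) (0, v))) (at x)"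
proof -
  have "((\<lambda>y. (t, y)) has_derivative (\<lambda>v. (0, v))) (at x)"
    by (auto intro!: derivative_eq_intros)
  then show ?thesis
    using has_derivative_compose[of "\<lambda>y. (t, y)" _ x UNIV \<Psi>] assms
    by (simp add: frechet_derivative_works)
qed

lemma local_lift_slice:
  fixes f :: "'t::real_normed_vector \<times> 'a::real_normed_vector \<Rightarrow> (complex^4) set"
  assumes "local_lift f (t, x) \<Psi>"
  shows "local_lift (\<lambda>y. f (t, y)) x (\<lambda>y. \<Psi> (t, y))"
  using assms open_slice smooth_on_slice unfolding local_lift_def by (metis mem_Collect_eq)

text \<open>A lift of the whole deformation restricts to a lift at time \<open>t\<close>. Hence the
  metrics at the various times are values of a single smooth function of time and place.\<close>

lemma fs_herm_slice:
  fixes f :: "'t::real_normed_vector \<times> 'a::real_normed_vector \<Rightarrow> (complex^4) set"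
  assumes "smooth_to_CP3 f S" "(t, x) \<in> S"
  shows "fs_herm (\<lambda>y. f (t, y)) x v w = fs_herm f (t, x) (0, v) (0, w)"
proof -
  obtain \<Psi> where lift: "local_lift f (t, x) \<Psi>"
    using assms unfolding smooth_to_CP3_def by blast
  then have "\<Psi> differentiable (at (t, x))"
    unfolding local_lift_def using smooth_on_differentiable by blast
  then have "frechet_derivative (\<lambda>y. \<Psi> (t, y)) (at x) = (\<lambda>v. frechet_derivative \<Psi> (at (t, x)) (0, v))"
    by (intro frechet_derivative_at_eq has_derivative_slice)
  then show ?thesis
    by (simp add: fs_herm_eq[OF lift] fs_herm_eq[OF local_lift_slice[OF lift]] hor_lift_def)
qed

lemma hopf_scale:
  assumes "cmod c = 1"
  shows "hopf (c *s p) = hopf p"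
proof -
  have "d *s p \<in> hopf (c *s p)" if "cmod d = 1" for d
  proof -
    have "d *s p = (d / c) *s (c *s p)" "cmod (d / c) = 1"
      using assms that by (auto simp: vec_eq_iff norm_divide)
    then show ?thesis unfolding hopf_def by blast
  qed
  then show ?thesis
    using assms by (auto simp: hopf_def norm_mult vector_smult_assoc)
qed

lemma S7I:
  assumes "herm p p = 1"
  shows "p \<in> S7"
proof -
  have "(norm p)\<^sup>2 = 1" using assms by (metis herm_self of_real_eq_1_iff)
  then have "norm p = 1" using power2_eq_1_iff[of "norm p"] norm_ge_zero[of p] by linarith
  then show ?thesis by simp
qed

lemma scale_S7: "cmod c = 1 \<Longrightarrow> p \<in> S7 \<Longrightarrow> c *s p \<in> S7"
proof -
  assume c: "cmod c = 1" and p: "p \<in> S7"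
  have "herm (c *s p) (c *s p) = (c * cnj c) * herm p p"
    by (simp add: herm_algebra)
  also have "\<dots> = 1"
    using p c complex_norm_square[of c] by (simp add: herm_self)
  finally show "c *s p \<in> S7" by (rule S7I)
qed

text \<open>Points of one fibre differ by a phase, and their Hermitian product recovers it. Written
  this way, the phase between two smooth lifts is a smooth function.\<close>

lemma hopf_eqD:
  assumes "hopf p = hopf q" "q \<in> S7"
  shows "cmod (herm q p) = 1" "herm q p *s p = q"
proof -
  have "q \<in> hopf q" unfolding hopf_def by (auto intro!: exI[of _ 1])
  then have "q \<in> hopf p" using assms by simp
  then obtain c where c: "cmod c = 1" "q = c *s p" by (auto simp: hopf_def)
  have "cnj c *s q = (cnj c * c) *s p" by (simp add: c(2) vector_smult_assoc)
  also have "\<dots> = p" using complex_norm_square[of c] c(1) by (simp add: mult.commute)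
  finally have "p = cnj c *s q" by simp
  then have "herm q p = c * herm q q" by (simp add: herm_algebra)
  also have "\<dots> = c" using assms(2) by (simp add: herm_self)
  finally show "cmod (herm q p) = 1" "herm q p *s p = q" using c by simp_all
qed

text \<open>Gauge fixing: multiplying a lift by a unit factor depending on \<open>x\<close> only makes it extend \<open>\<psi>\<close>.\<close>

lemma normalized_lift:
  fixes f :: "real \<times> 'a::real_normed_vector \<Rightarrow> (complex^4) set"
  assumes "smooth_to_CP3 f S" "(0, x) \<in> S" "smooth_on \<psi> UNIV"
    and "\<And>y. \<psi> y \<in> S7" "\<And>y. f (0, y) = hopf (\<psi> y)"
  obtains \<Psi> U where "open U" "(0, x) \<in> U" "smooth_on \<Psi> U"
    "\<And>p. p \<in> U \<Longrightarrow> \<Psi> p \<in> S7 \<and> hopf (\<Psi> p) = f p"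
    "\<And>y. (0, y) \<in> U \<Longrightarrow> \<Psi> (0, y) = \<psi> y"
proof -
  obtain \<Phi> V where V: "open V" "(0, x) \<in> V" "smooth_on \<Phi> V"
      "\<And>p. p \<in> V \<Longrightarrow> \<Phi> p \<in> S7 \<and> hopf (\<Phi> p) = f p"
    using assms(1,2) unfolding smooth_to_CP3_def local_lift_def by metis
  define L where "L = (\<lambda>p::real \<times> 'a. (0::real, snd p))"
  have L: "bounded_linear L"
    unfolding L_def by (rule bounded_linear_Pair[OF bounded_linear_zero bounded_linear_snd])
  \<comment> \<open>Both a point and its projection to time zero must lie in \<open>V\<close>, as
    the phase is read off at time zero.\<close>
  define U where "U = V \<inter> L -` V"
  define c where "c p = herm (\<psi> (snd p)) (\<Phi> (L p))" for p
  have "open (L -` V)"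
    by (intro open_vimage V(1) linear_continuous_on L)
  then have opU: "open U" by (simp add: U_def V(1) open_Int)
  have cc: "cmod (c p) = 1 \<and> c p *s \<Phi> (L p) = \<psi> (snd p)" if "p \<in> U" for p
  proof -
    have "hopf (\<Phi> (L p)) = hopf (\<psi> (snd p))"
      using that V(4)[of "L p"] assms(5) by (auto simp: U_def L_def)
    from hopf_eqD[OF this assms(4)] show ?thesis by (simp add: c_def)
  qed
  show ?thesis
  proof (rule that[OF opU, of "\<lambda>p. c p *s \<Phi> p"])
    show "(0, x) \<in> U" using V(2) by (simp add: U_def L_def)
    have "smooth_on (\<lambda>p. \<psi> (snd p)) U"
      using smooth_on_compose_linear[OF open_UNIV bounded_linear_snd assms(3)]
      by (rule smooth_on_subset) auto
    moreover have "smooth_on (\<lambda>p. \<Phi> (L p)) U"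
      using smooth_on_compose_linear[OF V(1) L V(3)] by (rule smooth_on_subset) (auto simp: U_def)
    ultimately have "smooth_on c U"
      unfolding c_def by (intro smooth_on_herm opU)
    then show "smooth_on (\<lambda>p. c p *s \<Phi> p) U"
      by (rule smooth_on_bilinear[OF opU bounded_bilinear_scale])
        (rule smooth_on_subset[OF V(3)], simp add: U_def)
    show "c p *s \<Phi> p \<in> S7 \<and> hopf (c p *s \<Phi> p) = f p" if "p \<in> U" for p
      using cc[OF that] V(4)[of p] that scale_S7 hopf_scale by (simp add: U_def)
    show "c (0, y) *s \<Phi> (0, y) = \<psi> y" if "(0, y) \<in> U" for y
      using cc[OF that] by (simp add: L_def)
  qed
qed

section \<open>First variation of the volume\<close>

definition partial :: "(real^'n \<Rightarrow> 'b::real_normed_vector) \<Rightarrow> 'n \<Rightarrow> real^'n \<Rightarrow> 'b" where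
  "partial f k p = frechet_derivative f (at p) (axis k 1)"

lemma herm_zero [simp]: "herm 0 v = 0" "herm v 0 = 0"
  by (simp_all add: herm_def)

lemma herm_sum_left: "herm (\<Sum>i\<in>I. f i) v = (\<Sum>i\<in>I. herm (f i) v)"
  by (rule bounded_bilinear.sum_left[OF bounded_bilinear_herm])

lemma herm_sum_right: "herm v (\<Sum>i\<in>I. f i) = (\<Sum>i\<in>I. herm v (f i))"
  by (rule bounded_bilinear.sum_right[OF bounded_bilinear_herm])

lemma herm_scaleR: "herm (r *\<^sub>R u) v = r *\<^sub>R herm u v" "herm u (r *\<^sub>R v) = r *\<^sub>R herm u v"
  by (simp_all add: bounded_bilinear.scaleR_left[OF bounded_bilinear_herm]
      bounded_bilinear.scaleR_right[OF bounded_bilinear_herm])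

lemma frechet_derivative_expand:
  fixes f :: "real^'n \<Rightarrow> 'b::real_normed_vector"
  assumes "f differentiable (at p)"
  shows "frechet_derivative f (at p) v = (\<Sum>k\<in>UNIV. (v $ k) *\<^sub>R partial f k p)"
proof -
  have lin: "linear (frechet_derivative f (at p))"
    using linear_frechet_derivative[OF assms] .
  have "v = (\<Sum>k\<in>UNIV. (v $ k) *\<^sub>R axis k 1)"
    using basis_expansion[of v] by (simp add: scalar_mult_eq_scaleR)
  then have "frechet_derivative f (at p) v =
      frechet_derivative f (at p) (\<Sum>k\<in>UNIV. (v $ k) *\<^sub>R axis k 1)"
    by simp
  then show ?thesis
    by (simp add: linear_sum[OF lin] linear_cmul[OF lin] partial_def)
qed

text \<open>
  The mean curvature assumption says that the Lagrangian angle of \<open>hopf \<circ> \<psi>\<close> has differential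
  \<open>\<Sum>\<^sub>k (n k / \<sigma>) dx\<^sub>k\<close>. For the metric \<open>\<sigma>\<^sup>2 |dx|\<^sup>2\<close> this form is coclosed iff \<open>\<Sum>\<^sub>k \<partial>\<^sub>k (n k) = 0\<close>;
  the last assumption makes every summand vanish.
\<close>

locale horizontal_conformal_lift =
  fixes \<psi> :: "real^3 \<Rightarrow> complex^4" and \<sigma> \<kappa> :: "real^3 \<Rightarrow> real" and n :: "3 \<Rightarrow> real^3 \<Rightarrow> real"
  assumes smooth: "smooth_on \<psi> UNIV"
    and sphere: "\<psi> p \<in> S7"
    and smooth_factor: "smooth_on \<sigma> UNIV"
    and factor_pos: "\<sigma> p > 0"
    and horizontal: "herm (partial \<psi> k p) (\<psi> p) = 0"
    and conformal: "herm (partial \<psi> j p) (partial \<psi> k p) = (if j = k then of_real ((\<sigma> p)\<^sup>2) else 0)"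
    and mean_curvature: "(\<Sum>k\<in>UNIV. partial (\<lambda>q. \<sigma> q *\<^sub>R partial \<psi> k q) k p) =
      - (\<kappa> p) *\<^sub>R \<psi> p + (\<Sum>k\<in>UNIV. (\<i> * of_real (n k p)) *s partial \<psi> k p)"
    and coeff_cont: "continuous_on UNIV (n k)"
    and coeff_invariant: "n k (p + s *\<^sub>R axis k 1) = n k p"
begin

lemma lift: "local_lift (hopf \<circ> \<psi>) p \<psi>"
  unfolding local_lift_def using smooth sphere by (intro exI[of _ UNIV]) auto

lemma derivative_expand: "frechet_derivative \<psi> (at p) v = (\<Sum>k\<in>UNIV. (v $ k) *\<^sub>R partial \<psi> k p)"
  using frechet_derivative_expand[OF smooth_on_differentiable[OF smooth]] by simp

lemma horizontal_derivative: "herm (frechet_derivative \<psi> (at p) v) (\<psi> p) = 0"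
  by (simp add: derivative_expand herm_sum_left herm_scaleR horizontal)

text \<open>In the expansion by partial derivatives only the diagonal terms survive. That the value
  is real gives the Lagrangian property; its size gives conformal flatness.\<close>

lemma fs_herm_eq_conformal: "fs_herm (hopf \<circ> \<psi>) p v w = of_real ((\<sigma> p)\<^sup>2 * (v \<bullet> w))"
proof -
  have "fs_herm (hopf \<circ> \<psi>) p v w =
      herm (frechet_derivative \<psi> (at p) v) (frechet_derivative \<psi> (at p) w)"
    by (simp add: fs_herm_eq[OF lift] hor_lift_def hor_part_def horizontal_derivative)
  also have "\<dots> = (\<Sum>j\<in>UNIV. \<Sum>k\<in>UNIV. (w $ j) *\<^sub>R (v $ k) *\<^sub>R
      (if k = j then of_real ((\<sigma> p)\<^sup>2) else 0))"
    by (simp add: derivative_expand herm_sum_left herm_sum_right herm_scaleR conformal scaleR_sum_right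
        del: scaleR_scaleR)
  also have "\<dots> = (\<Sum>j\<in>UNIV. (w $ j) *\<^sub>R (v $ j) *\<^sub>R of_real ((\<sigma> p)\<^sup>2))"
    by (intro sum.cong refl) (simp add: if_distrib sum.delta del: scaleR_scaleR cong: if_cong)
  also have "\<dots> = of_real ((\<sigma> p)\<^sup>2 * (v \<bullet> w))"
    by (simp add: inner_vec_def sum_distrib_left mult_ac scaleR_conv_of_real)
  finally show ?thesis .
qed

lemma conformally_flat_hopf: "conformally_flat (hopf \<circ> \<psi>)"
  unfolding conformally_flat_def fs_metric_def fs_herm_eq_conformal
  using factor_pos[THEN less_imp_neq, THEN not_sym]
  by (intro exI[of _ "\<lambda>p. (\<sigma> p)\<^sup>2"]) simp

lemma Lagrangian_hopf: "Lagrangian_immersion (hopf \<circ> \<psi>)"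
proof -
  \<comment> \<open>The lift of a tangent vector determines its products with all other lifts, and
    these determine the vector because the pulled back form is nondegenerate.\<close>
  have "inj (tangent_lift (hopf \<circ> \<psi>) p)" for p
  proof (rule injI)
    fix v w assume eq: "tangent_lift (hopf \<circ> \<psi>) p v = tangent_lift (hopf \<circ> \<psi>) p w"
    have "fs_herm (hopf \<circ> \<psi>) p v u = fs_herm (hopf \<circ> \<psi>) p w u" for u
      by (simp add: fs_herm_def eq)
    then have "v \<bullet> u = w \<bullet> u" for u
      unfolding fs_herm_eq_conformal of_real_eq_iff using factor_pos[of p] by (metis less_irrefl mult_left_cancel zero_less_power)
    then show "v = w" by (metis vector_eq_rdot)
  qed
  moreover have "smooth_to_CP3 (hopf \<circ> \<psi>) UNIV"
    unfolding smooth_to_CP3_def using lift by blast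
  ultimately show ?thesis
    unfolding Lagrangian_immersion_def immersion_to_CP3_def fs_omega_def fs_herm_eq_conformal
    by simp
qed

text \<open>Here \<open>f\<close> is a deformation of \<open>hopf \<circ> \<psi>\<close>, regarded
  as one map of time and place and studied at time zero over the point \<open>x\<close>.\<close>

context
  fixes f :: "real \<times> (real^3) \<Rightarrow> (complex^4) set" and S :: "(real \<times> (real^3)) set" and x :: "real^3"
  assumes f: "smooth_to_CP3 f S" "\<And>y. f (0, y) = hopf (\<psi> y)" "(0, x) \<in> S"
begin

text \<open>By \<open>volume_density\<close> the left side is the time derivative, at time zero, of
  the square root of the determinant. On the right stand a divergence and the pairing of the
  curvature coefficients with the form that a Hamiltonian deformation makes exact.\<close>

lemma first_variation:
  shows "(\<sigma> x / 2) * (\<Sum>k\<in>UNIV. frechet_derivative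
      (\<lambda>p. fs_metric f p (0, axis k 1) (0, axis k 1)) (at (0, x)) (1, 0)) =
    (\<Sum>k\<in>UNIV. partial (\<lambda>y. \<sigma> y * fs_metric f (0, y) (1, 0) (0, axis k 1)) k x) -
    (\<Sum>k\<in>UNIV. n k x * fs_omega f (0, x) (1, 0) (0, axis k 1))"
proof -
  obtain \<Psi> U where U: "open U" "(0, x) \<in> U" "smooth_on \<Psi> U"
    and \<Psi>: "\<And>p. p \<in> U \<Longrightarrow> \<Psi> p \<in> S7 \<and> hopf (\<Psi> p) = f p"
    and norm: "\<And>y. (0, y) \<in> U \<Longrightarrow> \<Psi> (0, y) = \<psi> y"
    using normalized_lift[OF f(1,3) smooth sphere f(2)] by metis
  let ?\<tau> = "(1, 0) :: real \<times> (real^3)"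
  let ?e = "\<lambda>k. (0, axis k 1) :: real \<times> (real^3)"
  define D where "D w p = frechet_derivative \<Psi> (at p) w" for w p
  have D_smooth: "smooth_on (D w) U" for w
    unfolding D_def[abs_def] by (rule smooth_on_derivative[OF U(3)])
  define T where "T = {y. (0, y) \<in> U}"
  have T: "open T" "x \<in> T" using open_slice[OF U(1)] U(2) by (auto simp: T_def)
  have D_partial: "D (?e k) (0, y) = partial \<psi> k y" if "y \<in> T" for k y
  proof -
    have "((\<lambda>y. \<Psi> (0, y)) has_derivative (\<lambda>v. D (0, v) (0, y))) (at y)"
      unfolding D_def using that by (intro has_derivative_slice smooth_on_differentiable[OF U(3)]) (simp add: T_def)
    then have "(\<psi> has_derivative (\<lambda>v. D (0, v) (0, y))) (at y)"
      using T(1) that norm by (rule has_derivative_transform_within_open) (auto simp: T_def)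
    then show ?thesis
      unfolding partial_def by (simp add: frechet_derivative_at_eq)
  qed
  define V where "V y = D ?\<tau> (0, y)" for y
  define A where "A k = frechet_derivative (D ?\<tau>) (at (0, x)) (?e k)" for k
  \<comment> \<open>Symmetry of second derivatives: the time derivative of a spatial partial is the
    spatial partial of the velocity. So the same \<open>A k\<close> enters the variation of the
    metric and the divergence.\<close>
  have A_eq: "frechet_derivative (D (?e k)) (at (0, x)) ?\<tau> = A k" for k
    unfolding A_def D_def[abs_def] by (rule frechet_derivative_commute[OF U])
  have dD: "(D w has_derivative frechet_derivative (D w) (at (0, x))) (at (0, x))" for w
    by (rule smooth_on_has_derivative[OF D_smooth U(2)])
  have dV: "(V has_derivative (\<lambda>v. frechet_derivative (D ?\<tau>) (at (0, x)) (0, v))) (at x)"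
    unfolding V_def[abs_def]
    by (intro has_derivative_slice smooth_on_differentiable[OF D_smooth U(2)])
  have d\<Psi>: "(\<Psi> has_derivative (\<lambda>w. D w (0, x))) (at (0, x))"
    using smooth_on_has_derivative[OF U(3,2)] by (simp add: D_def)
  \<comment> \<open>Obtained by differentiating norm one in time; it removes the component of
    \<open>mean_curvature\<close> along \<open>\<psi>\<close> below.\<close>
  have V\<psi>: "Re (herm (V x) (\<psi> x)) = 0"
  proof -
    have "((\<lambda>p. herm (\<Psi> p) (\<Psi> p)) has_derivative
        (\<lambda>w. herm (\<Psi> (0, x)) (D w (0, x)) + herm (D w (0, x)) (\<Psi> (0, x)))) (at (0, x))"
      by (rule bounded_bilinear.FDERIV[OF bounded_bilinear_herm d\<Psi> d\<Psi>])
    moreover have "((\<lambda>p. herm (\<Psi> p) (\<Psi> p)) has_derivative (\<lambda>w. 0)) (at (0, x))"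
      by (rule has_derivative_transform_within_open[OF has_derivative_const U(1,2), of 1])
        (use \<Psi> in \<open>auto simp: herm_self\<close>)
    ultimately have "(\<lambda>w. herm (\<Psi> (0, x)) (D w (0, x)) + herm (D w (0, x)) (\<Psi> (0, x))) = (\<lambda>w. 0)"
      by (rule has_derivative_unique)
    from fun_cong[OF this, of ?\<tau>] have "herm (\<psi> x) (V x) + herm (V x) (\<psi> x) = 0"
      unfolding V_def norm[OF U(2)] .
    then show ?thesis
      using herm_cnj[of "\<psi> x" "V x"] by (simp add: complex_eq_iff)
  qed
  have fs: "fs_herm f (0, y) ?\<tau> (?e k) = herm (V y) (partial \<psi> k y)" if "y \<in> T" for k y
  proof -
    have "herm (\<psi> y) (partial \<psi> k y) = 0"
      using herm_cnj[of "\<psi> y" "partial \<psi> k y"] horizontal[of k y] by simp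
    then show ?thesis
      using fs_herm_local[OF U(1,3) \<Psi>, of "(0, y)" ?\<tau> "?e k"] that D_partial[OF that, of k] norm[of y]
      by (simp add: D_def V_def T_def)
  qed
  \<comment> \<open>The correction term is a product of two factors that both vanish at time zero,
    \<open>\<psi>\<close> being horizontal, so it contributes nothing to the first
    derivative.\<close>
  have metric_dt: "frechet_derivative (\<lambda>p. fs_metric f p (?e k) (?e k)) (at (0, x)) ?\<tau> =
      2 * Re (herm (A k) (partial \<psi> k x))" for k
  proof -
    let ?g = "\<lambda>p. Re (herm (D (?e k) p) (D (?e k) p) - herm (D (?e k) p) (\<Psi> p) * herm (\<Psi> p) (D (?e k) p))"
    note dDk = dD[of "?e k"]
    have h0: "herm (D (?e k) (0, x)) (\<Psi> (0, x)) = 0" "herm (\<Psi> (0, x)) (D (?e k) (0, x)) = 0"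
      using horizontal[of k x] herm_cnj[of "\<psi> x" "partial \<psi> k x"] D_partial[OF T(2)] norm U(2) by auto
    have "(?g has_derivative (\<lambda>w. Re (herm (D (?e k) (0, x)) (frechet_derivative (D (?e k)) (at (0, x)) w) +
        herm (frechet_derivative (D (?e k)) (at (0, x)) w) (D (?e k) (0, x)) -
        (herm (D (?e k) (0, x)) (\<Psi> (0, x)) *
          (herm (\<Psi> (0, x)) (frechet_derivative (D (?e k)) (at (0, x)) w) + herm (D w (0, x)) (D (?e k) (0, x))) +
         (herm (D (?e k) (0, x)) (D w (0, x)) + herm (frechet_derivative (D (?e k)) (at (0, x)) w) (\<Psi> (0, x))) *
          herm (\<Psi> (0, x)) (D (?e k) (0, x)))))) (at (0, x))"
      by (intro bounded_linear.has_derivative[OF bounded_linear_Re] has_derivative_diff has_derivative_mult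
          bounded_bilinear.FDERIV[OF bounded_bilinear_herm] dDk d\<Psi>)
    then have "((\<lambda>p. fs_metric f p (?e k) (?e k)) has_derivative
        (\<lambda>w. Re (herm (partial \<psi> k x) (frechet_derivative (D (?e k)) (at (0, x)) w) +
          herm (frechet_derivative (D (?e k)) (at (0, x)) w) (partial \<psi> k x)))) (at (0, x))"
      unfolding h0 mult_zero_left mult_zero_right add_0 diff_zero
      unfolding D_partial[OF T(2)]
      by (rule has_derivative_transform_within_open[OF _ U(1,2)])
        (simp add: fs_metric_def fs_herm_local[OF U(1,3) \<Psi>] D_def)
    then show ?thesis
      by (simp add: frechet_derivative_at_eq A_eq herm_cnj[of "partial \<psi> k x" "A k"])
  qed
  have W_deriv: "partial (\<lambda>y. \<sigma> y * fs_metric f (0, y) ?\<tau> (?e k)) k x =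
      Re (herm (V x) (partial (\<lambda>q. \<sigma> q *\<^sub>R partial \<psi> k q) k x)) +
      \<sigma> x * Re (herm (A k) (partial \<psi> k x))" for k
  proof -
    have sm: "smooth_on (\<lambda>q. \<sigma> q *\<^sub>R partial \<psi> k q) UNIV"
      unfolding partial_def
      by (intro smooth_on_bilinear[OF _ bounded_bilinear_scaleR] smooth_on_derivative smooth smooth_factor) simp
    note dS = smooth_on_has_derivative[OF sm UNIV_I, of x]
    have "((\<lambda>y. Re (herm (V y) (\<sigma> y *\<^sub>R partial \<psi> k y))) has_derivative
        (\<lambda>v. Re (herm (V x) (frechet_derivative (\<lambda>q. \<sigma> q *\<^sub>R partial \<psi> k q) (at x) v) +
          herm (frechet_derivative (D ?\<tau>) (at (0, x)) (0, v)) (\<sigma> x *\<^sub>R partial \<psi> k x)))) (at x)"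
      by (intro bounded_linear.has_derivative[OF bounded_linear_Re]
          bounded_bilinear.FDERIV[OF bounded_bilinear_herm] dV dS)
    then have "((\<lambda>y. \<sigma> y * fs_metric f (0, y) ?\<tau> (?e k)) has_derivative
        (\<lambda>v. Re (herm (V x) (frechet_derivative (\<lambda>q. \<sigma> q *\<^sub>R partial \<psi> k q) (at x) v) +
          herm (frechet_derivative (D ?\<tau>) (at (0, x)) (0, v)) (\<sigma> x *\<^sub>R partial \<psi> k x)))) (at x)"
      by (rule has_derivative_transform_within_open[OF _ T])
        (simp add: fs_metric_def fs herm_scaleR)
    then show ?thesis
      unfolding partial_def[of "\<lambda>y. \<sigma> y * fs_metric f (0, y) ?\<tau> (?e k)"]
      by (simp add: frechet_derivative_at_eq A_def herm_scaleR) (simp add: partial_def)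
  qed
  have "(\<Sum>k\<in>UNIV. Re (herm (V x) (partial (\<lambda>q. \<sigma> q *\<^sub>R partial \<psi> k q) k x))) =
      Re (herm (V x) (\<Sum>k\<in>UNIV. partial (\<lambda>q. \<sigma> q *\<^sub>R partial \<psi> k q) k x))"
    by (simp add: herm_sum_right)
  \<comment> \<open>The coefficient i n is conjugated in the second argument of \<open>herm\<close>,
    and Re (- i n z) = n Im z for real n turns the Hermitian products into values of
    \<open>fs_omega\<close>.\<close>
  also have "\<dots> = (\<Sum>k\<in>UNIV. n k x * fs_omega f (0, x) ?\<tau> (?e k))"
    unfolding mean_curvature
    by (simp add: herm_algebra herm_scaleR herm_sum_right V\<psi> fs_omega_def fs[OF T(2)])
  finally have curv: "(\<Sum>k\<in>UNIV. Re (herm (V x) (partial (\<lambda>q. \<sigma> q *\<^sub>R partial \<psi> k q) k x))) =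
      (\<Sum>k\<in>UNIV. n k x * fs_omega f (0, x) ?\<tau> (?e k))" .
  show ?thesis
    unfolding metric_dt W_deriv sum.distrib curv
    by (simp add: sum_distrib_left mult_ac)
qed

text \<open>At time zero the matrix is \<open>(\<sigma> x)\<^sup>2\<close> times the identity: its
  diagonal cofactors are \<open>\<sigma> x ^ 4\<close> and the others vanish. So only the trace of
  the variation of the metric remains.\<close>

lemma volume_density:
  fixes \<Delta>
  assumes S: "open S"
  defines "\<Delta> \<equiv> \<lambda>p. det (\<chi> i j. fs_metric f p (0, axis i 1) (0, axis j 1) :: real^3^3)"
  shows "\<Delta> (0, x) = \<sigma> x ^ 6"
    and "frechet_derivative \<Delta> (at (0, x)) (1, 0) = \<sigma> x ^ 4 *
      (\<Sum>k\<in>UNIV. frechet_derivative (\<lambda>p. fs_metric f p (0, axis k 1) (0, axis k 1)) (at (0, x)) (1, 0))"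
proof -
  define g where "g i j p = fs_metric f p (0, axis i 1) (0, axis j 1)" for i j :: 3 and p
  have g0: "g i j (0, x) = (if i = j then (\<sigma> x)\<^sup>2 else 0)" for i j
  proof -
    have "g i j (0, x) = fs_metric (\<lambda>y. f (0, y)) x (axis i 1) (axis j 1)"
      by (simp add: g_def fs_metric_def fs_herm_slice[OF f(1,3)])
    also have "(\<lambda>y. f (0, y)) = hopf \<circ> \<psi>" using f(2) by auto
    finally show ?thesis
      unfolding fs_metric_def fs_herm_eq_conformal by (simp add: inner_axis_axis)
  qed
  have \<Delta>: "\<Delta> = (\<lambda>p. g 1 1 p * g 2 2 p * g 3 3 p + g 1 2 p * g 2 3 p * g 3 1 p + g 1 3 p * g 2 1 p * g 3 2 p -
      g 1 1 p * g 2 3 p * g 3 2 p - g 1 2 p * g 2 1 p * g 3 3 p - g 1 3 p * g 2 2 p * g 3 1 p)"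
    by (simp add: \<Delta>_def det_3 g_def fun_eq_iff)
  show "\<Delta> (0, x) = \<sigma> x ^ 6"
    by (simp add: \<Delta> g0 flip: power_add)
  have "smooth_on (g i j) S" for i j
    unfolding g_def[abs_def] by (rule smooth_on_fs_metric[OF S f(1)])
  then have dg: "(g i j has_derivative frechet_derivative (g i j) (at (0, x))) (at (0, x))" for i j
    using smooth_on_has_derivative f(3) by blast
  have "(\<Delta> has_derivative (\<lambda>w. \<sigma> x ^ 4 * (frechet_derivative (g 1 1) (at (0, x)) w +
      frechet_derivative (g 2 2) (at (0, x)) w + frechet_derivative (g 3 3) (at (0, x)) w))) (at (0, x))"
    unfolding \<Delta>
    by (rule has_derivative_eq_rhs, (rule has_derivative_add has_derivative_diff has_derivative_mult dg)+)
      (simp add: g0 fun_eq_iff algebra_simps flip: power_add)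
  then show "frechet_derivative \<Delta> (at (0, x)) (1, 0) = \<sigma> x ^ 4 *
      (\<Sum>k\<in>UNIV. frechet_derivative (\<lambda>p. fs_metric f p (0, axis k 1) (0, axis k 1)) (at (0, x)) (1, 0))"
    by (simp add: frechet_derivative_at_eq sum_3 g_def[abs_def])
qed

end

end

text \<open>\<open>K\<close> is an arbitrary compact set, so differentiation under the integral is
  done over a box around it. The integrand is stationary off \<open>K\<close>, hence the two
  integrals differ by a constant in \<open>t\<close>.\<close>

lemma has_real_derivative_integral_compact:
  fixes \<delta> \<delta>' :: "real \<Rightarrow> 'a::euclidean_space \<Rightarrow> real"
  assumes K: "compact K" "K \<subseteq> cbox a b" and \<eta>: "\<eta> > 0"
    and der: "\<And>t x. \<bar>t\<bar> < \<eta> \<Longrightarrow> x \<in> cbox a b \<Longrightarrow> ((\<lambda>t. \<delta> t x) has_real_derivative \<delta>' t x) (at t)"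
    and cont: "\<And>t. \<bar>t\<bar> < \<eta> \<Longrightarrow> continuous_on (cbox a b) (\<delta> t)"
    and cont': "continuous_on ({-\<eta><..<\<eta>} \<times> cbox a b) (\<lambda>(t, x). \<delta>' t x)"
    and stat: "\<And>t x. \<bar>t\<bar> < \<eta> \<Longrightarrow> x \<in> cbox a b - K \<Longrightarrow> \<delta> t x = \<delta> 0 x"
  shows "((\<lambda>t. integral K (\<delta> t)) has_real_derivative integral (cbox a b) (\<delta>' 0)) (at 0)"
proof -
  have intK: "\<delta> t integrable_on K" if "\<bar>t\<bar> < \<eta>" for t
  proof -
    have "set_integrable lborel K (\<delta> t)"
      unfolding set_integrable_def
      by (rule borel_integrable_compact[OF K(1) continuous_on_subset[OF cont[OF that] K(2)]])
    then show ?thesis by (rule set_borel_integral_eq_integral)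
  qed
  have intB: "\<delta> t integrable_on cbox a b" if "\<bar>t\<bar> < \<eta>" for t
    by (rule integrable_continuous[OF cont[OF that]])
  have eq: "integral (cbox a b) (\<delta> t) + (integral K (\<delta> 0) - integral (cbox a b) (\<delta> 0)) = integral K (\<delta> t)"
    if "\<bar>t\<bar> < \<eta>" for t
  proof -
    have "integral (cbox a b) (\<lambda>x. \<delta> t x - \<delta> 0 x) = integral K (\<lambda>x. \<delta> t x - \<delta> 0 x)"
      by (rule integral_superset_zero[OF K(2)]) (use stat[OF that] in simp)
    then show ?thesis
      using intK intB that \<eta> by (simp add: Henstock_Kurzweil_Integration.integral_diff)
  qed
  have "((\<lambda>t. integral (cbox a b) (\<delta> t)) has_field_derivative integral (cbox a b) (\<delta>' 0))
      (at 0 within {-\<eta><..<\<eta>})"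
    by (rule leibniz_rule_field_derivative)
      (use \<eta> der intB cont' in \<open>auto intro: has_field_derivative_at_within\<close>)
  moreover have "at 0 within {-\<eta><..<\<eta>} = at 0"
    by (rule at_within_open) (use \<eta> in auto)
  ultimately have "((\<lambda>t. integral (cbox a b) (\<delta> t)) has_field_derivative integral (cbox a b) (\<delta>' 0)) (at 0)"
    by (simp only:)
  then have "((\<lambda>t. integral (cbox a b) (\<delta> t) + (integral K (\<delta> 0) - integral (cbox a b) (\<delta> 0)))
      has_field_derivative (integral (cbox a b) (\<delta>' 0) + 0)) (at 0)"
    by (intro DERIV_add DERIV_const)
  then have "((\<lambda>t. integral K (\<delta> t)) has_real_derivative (integral (cbox a b) (\<delta>' 0) + 0)) (at 0)"
    by (rule has_field_derivative_transform_within_open[where S = "{-\<eta><..<\<eta>}"])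
      (use \<eta> eq in auto)
  then show ?thesis by (simp only: add_0_right)
qed

lemma has_real_derivative_line:
  fixes g :: "'a::real_normed_vector \<Rightarrow> real"
  assumes "g differentiable (at p)"
  shows "((\<lambda>s. g (p + s *\<^sub>R v)) has_real_derivative frechet_derivative g (at p) v) (at 0)"
proof -
  have "((\<lambda>s. p + s *\<^sub>R v) has_derivative (\<lambda>h. h *\<^sub>R v)) (at 0)"
    by (auto intro!: derivative_eq_intros)
  moreover have "(g has_derivative frechet_derivative g (at p)) (at (p + 0 *\<^sub>R v))"
    using assms by (simp add: frechet_derivative_works)
  ultimately have "((\<lambda>s. g (p + s *\<^sub>R v)) has_derivative (\<lambda>h. frechet_derivative g (at p) (h *\<^sub>R v))) (at 0)"
    by (rule has_derivative_compose)
  moreover have "frechet_derivative g (at p) (h *\<^sub>R v) = frechet_derivative g (at p) v * h" for h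
    using linear_cmul[OF linear_frechet_derivative[OF assms], of h v] by simp
  ultimately show ?thesis by (simp add: has_field_derivative_def)
qed

lemma has_real_derivative_slice:
  fixes f :: "real \<times> 'a::real_normed_vector \<Rightarrow> real"
  assumes "f differentiable (at (t, x))"
  shows "((\<lambda>t. f (t, x)) has_real_derivative frechet_derivative f (at (t, x)) (1, 0)) (at t)"
proof -
  have "((\<lambda>s. f ((t, x) + s *\<^sub>R (1, 0))) has_real_derivative frechet_derivative f (at (t, x)) (1, 0)) (at (t + - t))"
    using has_real_derivative_line[OF assms, of "(1, 0)"] by simp
  then have "((\<lambda>s. f ((t, x) + (s + - t) *\<^sub>R (1, 0))) has_real_derivative
      frechet_derivative f (at (t, x)) (1, 0)) (at t)"
    by (rule DERIV_shift[THEN iffD1])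
  then show ?thesis by simp
qed

lemma smooth_on_det3:
  fixes g :: "3 \<Rightarrow> 3 \<Rightarrow> 'a::real_normed_vector \<Rightarrow> real"
  assumes "open S" "\<And>i j. smooth_on (g i j) S"
  shows "smooth_on (\<lambda>p. det (\<chi> i j. g i j p :: real^3^3)) S"
  by (simp add: det_3) (intro smooth_on_add smooth_on_diff smooth_on_mult assms)

text \<open>The complement of a bounded convex set is connected in dimension at least two, so one
  constant serves all points outside.\<close>

lemma derivative_zero_outside_box:
  fixes h :: "'a::euclidean_space \<Rightarrow> real"
  assumes "2 \<le> DIM('a)" "\<And>x. (h has_derivative h' x) (at x)" "\<And>x v. x \<notin> cbox a b \<Longrightarrow> h' x v = 0"
  obtains c where "\<And>x. x \<notin> cbox a b \<Longrightarrow> h x = c"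
proof -
  have "connected (- cbox a b)"
    by (rule connected_complement_bounded_convex) (use assms(1) in auto)
  moreover have "(h has_derivative (\<lambda>v. 0)) (at x)" if "x \<in> - cbox a b" for x
  proof -
    have "h' x = (\<lambda>v. 0)" using assms(3) that by auto
    then show ?thesis using assms(2)[of x] by simp
  qed
  ultimately have "h x = h y" if "x \<in> - cbox a b" "y \<in> - cbox a b" for x y
    using that by (intro has_derivative_zero_unique_connected[of "- cbox a b"]) (simp_all add: open_Compl closed_cbox)
  then show ?thesis
    using that[of "h (SOME x. x \<in> - cbox a b)"] by (metis ComplI someI)
qed

section \<open>Criticality of the volume under Hamiltonian deformations\<close>

context horizontal_conformal_lift
begin

lemma H_minimal_hopf: "H_minimal (hopf \<circ> \<psi>)"
  unfolding H_minimal_def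
proof (intro allI impI, elim conjE)
  fix K \<epsilon> F
  assume K: "compact K" and \<epsilon>: "\<epsilon> > 0" and HD: "Hamiltonian_deformation (hopf \<circ> \<psi>) K \<epsilon> F"
  define f where "f = (\<lambda>(t, x). F t x)"
  define S where "S = {-\<epsilon><..<\<epsilon>} \<times> (UNIV :: (real^3) set)"
  have S: "open S" "\<And>t x. (t, x) \<in> S \<longleftrightarrow> \<bar>t\<bar> < \<epsilon>"
    by (auto simp: S_def open_Times)
  have ball_eq: "(\<forall>t\<in>{-\<epsilon><..<\<epsilon>}. P t) = (\<forall>t. \<bar>t\<bar> < \<epsilon> \<longrightarrow> P t)" for P
    by (auto simp: abs_less_iff)
  have f: "smooth_to_CP3 f S" and F0: "F 0 = hopf \<circ> \<psi>"
    and fK: "\<And>t x. \<bar>t\<bar> < \<epsilon> \<Longrightarrow> x \<notin> K \<Longrightarrow> F t x = (hopf \<circ> \<psi>) x"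
    and ham: "\<And>t. \<bar>t\<bar> < \<epsilon> \<Longrightarrow> \<exists>h. smooth_on h UNIV \<and>
      (\<forall>x v. fs_omega f (t, x) (1, 0) (0, v) = (frechet_derivative h (at x) v :: real))"
    using HD unfolding Hamiltonian_deformation_def f_def S_def ball_eq by blast+
  have f0: "f (0, y) = hopf (\<psi> y)" for y by (simp add: f_def F0)
  obtain h where h: "smooth_on h UNIV"
      "\<And>x v. fs_omega f (0, x) (1, 0) (0, v) = (frechet_derivative h (at x) v :: real)"
    using ham[of 0] \<epsilon> by auto
  have dh: "(h has_derivative frechet_derivative h (at x)) (at x)" for x
    by (rule smooth_on_has_derivative[OF h(1) UNIV_I])
  obtain b where b: "K \<subseteq> cbox (-b) b"
    using bounded_subset_cbox_symmetric compact_imp_bounded[OF K] by blast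
  have opK: "open (- K)" using K by (simp add: compact_imp_closed open_Compl)

  \<comment> \<open>Off \<open>K\<close> the map sending \<open>(t, x)\<close> to
    \<open>\<psi> x\<close> is itself a lift of the deformation, and its velocity is zero.\<close>
  have off: "fs_herm f (0, x) (1, 0) w = 0" if "x \<notin> K" for x w
  proof -
    let ?U = "{-\<epsilon><..<\<epsilon>} \<times> (- K)"
    have U: "open ?U" "(0, x) \<in> ?U" using opK that \<epsilon> by (auto intro: open_Times)
    have sm: "smooth_on (\<lambda>p. \<psi> (snd p)) ?U"
      using smooth_on_compose_linear[OF open_UNIV bounded_linear_snd smooth]
      by (rule smooth_on_subset) auto
    have "((\<lambda>p. \<psi> (snd p)) has_derivative (\<lambda>w. frechet_derivative \<psi> (at (snd (0::real, x))) (snd w))) (at (0, x))"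
      by (rule has_derivative_compose[OF has_derivative_snd[OF has_derivative_ident]])
        (use smooth_on_has_derivative[OF smooth] in simp)
    from fun_cong[OF frechet_derivative_at_eq[OF this], of "(1, 0)"]
    have "frechet_derivative (\<lambda>p. \<psi> (snd p)) (at (0::real, x)) (1, 0) = 0"
      by (simp add: derivative_expand)
    then show ?thesis
      by (subst fs_herm_local[OF U(1) sm _ U(2)])
        (use sphere fK in \<open>auto simp: f_def abs_less_iff\<close>)
  qed
  have dh_off: "frechet_derivative h (at x) v = 0" if "x \<notin> cbox (-b) b" for x v
  proof -
    have "x \<notin> K" using that b by blast
    then show ?thesis using h(2)[of x v] off by (simp add: fs_omega_def)
  qed
  obtain c where c: "\<And>x. x \<notin> cbox (-b) b \<Longrightarrow> h x = c"
    using derivative_zero_outside_box[OF _ dh dh_off] by auto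

  define g where "g i j p = fs_metric f p (0, axis i 1) (0, axis j 1)" for i j :: 3 and p
  define \<Delta> where "\<Delta> p = det (\<chi> i j. g i j p :: real^3^3)" for p
  have g_smooth: "smooth_on (g i j) S" for i j
    unfolding g_def[abs_def] by (rule smooth_on_fs_metric[OF S(1) f])
  have \<Delta>_smooth: "smooth_on \<Delta> S"
    unfolding \<Delta>_def[abs_def] by (rule smooth_on_det3[OF S(1) g_smooth])
  have \<Delta>0: "\<Delta> (0, x) = \<sigma> x ^ 6"
    and \<Delta>0': "frechet_derivative \<Delta> (at (0, x)) (1, 0) = \<sigma> x ^ 4 *
      (\<Sum>k\<in>UNIV. frechet_derivative (\<lambda>p. fs_metric f p (0, axis k 1) (0, axis k 1)) (at (0, x)) (1, 0))" for x
    using volume_density[OF f f0 _ S(1), of x] \<epsilon> S(2) by (auto simp: \<Delta>_def[abs_def] g_def)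
  have metric_eq: "fs_metric (F t) x (axis i 1) (axis j 1) = g i j (t, x)" if "\<bar>t\<bar> < \<epsilon>" for t x i j
    using fs_herm_slice[OF f, of t x] that S(2) by (simp add: g_def fs_metric_def f_def)
  have vol: "volume_on (F t) K = integral K (\<lambda>x. sqrt (\<Delta> (t, x)))" if "\<bar>t\<bar> < \<epsilon>" for t
    by (simp add: volume_on_def \<Delta>_def metric_eq[OF that])
  have stat: "\<Delta> (t, x) = \<Delta> (0, x)" if "\<bar>t\<bar> < \<epsilon>" "x \<notin> K" for t x
  proof -
    have "fs_herm (F t) x = fs_herm (F 0) x"
      by (rule fs_herm_cong[OF opK]) (use that fK \<epsilon> in \<open>auto simp: F0\<close>)
    then have "g i j (t, x) = g i j (0, x)" for i j
      using metric_eq[OF that(1), of x i j] metric_eq[of 0 x i j] \<epsilon> by (simp add: fs_metric_def)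
    then show ?thesis by (simp add: \<Delta>_def)
  qed

  \<comment> \<open>The square root is differentiable where the determinant is positive. This holds
    at time zero, and the tube lemma extends it over the whole box for a uniform time
    interval.\<close>
  define W where "W = S \<inter> \<Delta> -` {0<..}"
  have "open W"
    unfolding W_def
    by (rule continuous_open_preimage[OF smooth_on_continuous_on[OF \<Delta>_smooth] S(1) open_greaterThan])
  moreover have "{0} \<times> cbox (-b) b \<subseteq> W"
  proof -
    have "\<sigma> x ^ 6 > 0" for x using factor_pos by (rule zero_less_power)
    then show ?thesis using \<epsilon> by (auto simp: W_def S(2) \<Delta>0)
  qed
  ultimately have "\<exists>X. 0 \<in> X \<and> open X \<and> X \<times> cbox (-b) b \<subseteq> W"
    by (rule Elementary_Topology.tube_lemma[OF compact_cbox])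
  then obtain X where X: "0 \<in> X" "open X" "X \<times> cbox (-b) b \<subseteq> W"
    by blast
  then obtain \<eta> where \<eta>: "\<eta> > 0" "ball 0 \<eta> \<subseteq> X"
    using openE by blast
  have inW: "(t, x) \<in> W" if "\<bar>t\<bar> < \<eta>" "x \<in> cbox (-b) b" for t x
    using that X \<eta>(2) by (auto simp: subset_iff)
  then have inS: "(t, x) \<in> S" and pos: "\<Delta> (t, x) > 0" if "\<bar>t\<bar> < \<eta>" "x \<in> cbox (-b) b" for t x
    using that unfolding W_def by auto

  define \<delta>' where "\<delta>' t x = frechet_derivative \<Delta> (at (t, x)) (1, 0) * inverse (sqrt (\<Delta> (t, x))) / 2" for t x
  have deriv: "((\<lambda>t. integral K (\<lambda>x. sqrt (\<Delta> (t, x)))) has_real_derivative integral (cbox (-b) b) (\<delta>' 0)) (at 0)"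
  proof (rule has_real_derivative_integral_compact[OF K b \<eta>(1)])
    show "((\<lambda>t. sqrt (\<Delta> (t, x))) has_real_derivative \<delta>' t x) (at t)"
      if "\<bar>t\<bar> < \<eta>" "x \<in> cbox (-b) b" for t x
      unfolding \<delta>'_def
      using has_real_derivative_slice[OF smooth_on_differentiable[OF \<Delta>_smooth inS[OF that]]] pos[OF that]
      by (auto intro!: derivative_eq_intros)
    have sub: "{-\<eta><..<\<eta>} \<times> cbox (-b) b \<subseteq> S"
      using inS by (auto simp: abs_less_iff)
    note contS = continuous_on_subset[OF smooth_on_continuous_on[OF \<Delta>_smooth] sub]
      continuous_on_subset[OF smooth_on_continuous_on[OF smooth_on_derivative[OF \<Delta>_smooth]] sub]
    show "continuous_on (cbox (-b) b) (\<lambda>x. sqrt (\<Delta> (t, x)))" if "\<bar>t\<bar> < \<eta>" for t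
      by (intro continuous_intros continuous_on_compose2[OF contS(1)]) (use that in auto)
    show "continuous_on ({-\<eta><..<\<eta>} \<times> cbox (-b) b) (\<lambda>(t, x). \<delta>' t x)"
    proof -
      have "(\<lambda>(t, x). \<delta>' t x) = (\<lambda>p. frechet_derivative \<Delta> (at p) (1, 0) * inverse (sqrt (\<Delta> p)) / 2)"
        by (auto simp: \<delta>'_def)
      then show ?thesis
        using pos by (auto intro!: continuous_intros contS) (metis less_irrefl abs_less_iff minus_less_iff)
    qed
    show "sqrt (\<Delta> (t, x)) = sqrt (\<Delta> (0, x))" if "\<bar>t\<bar> < \<eta>" "x \<in> cbox (-b) b - K" for t x
      using that inS[of t x] stat[of t x] S(2) by auto
  qed

  \<comment> \<open>\<open>w k\<close> is the k-th component of the field whose divergence occurs in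
    \<open>first_variation\<close>. \<open>G' k\<close> is a full k-th partial derivative, because
    \<open>n k\<close> does not change along axis \<open>k\<close>.\<close>
  define w where "w k y = \<sigma> y * fs_metric f (0, y) (1, 0) (0, axis k 1)" for k y
  define G' where "G' k x = partial (w k) k x - n k x * frechet_derivative h (at x) (axis k 1)" for k x
  have w_smooth: "smooth_on (w k) UNIV" for k
  proof -
    have "smooth_on (\<lambda>y. fs_metric f (0, y) (1, 0) (0, axis k 1)) {y. (0, y) \<in> S}"
      by (rule smooth_on_slice[OF S(1) smooth_on_fs_metric[OF S(1) f]])
    then show ?thesis
      unfolding w_def[abs_def] using S(2) \<epsilon> by (intro smooth_on_mult smooth_factor) auto
  qed
  have \<delta>'0: "\<delta>' 0 x = (\<Sum>k\<in>UNIV. G' k x)" for x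
  proof -
    have pow: "\<sigma> x ^ 6 = (\<sigma> x ^ 3)\<^sup>2" by (simp flip: power_mult)
    have "sqrt (\<Delta> (0, x)) = \<sigma> x ^ 3"
      unfolding \<Delta>0 pow by (rule real_sqrt_unique) (use factor_pos[of x] in auto)
    then have "\<delta>' 0 x = (\<sigma> x / 2) * (\<Sum>k\<in>UNIV. frechet_derivative
        (\<lambda>p. fs_metric f p (0, axis k 1) (0, axis k 1)) (at (0, x)) (1, 0))"
      using factor_pos[of x] by (simp add: \<delta>'_def \<Delta>0' power_numeral_reduce field_simps)
    also have "\<dots> = (\<Sum>k\<in>UNIV. G' k x)"
      using first_variation[OF f f0, of x] S(2) \<epsilon> h(2)
      by (simp add: G'_def w_def[abs_def] sum_subtractf)
    finally show ?thesis .
  qed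
  have G'_cont: "continuous_on UNIV (G' k)" for k
    unfolding G'_def[abs_def] partial_def
    by (intro continuous_intros coeff_cont smooth_on_continuous_on[OF smooth_on_derivative]
        w_smooth h(1))
  \<comment> \<open>Subtracting \<open>c\<close> from \<open>h\<close> makes the differentiated
    function vanish outside the box and leaves the derivative unchanged.\<close>
  have "integral (cbox (-b) b) (G' k) = 0" for k
  proof (rule integral_directional_derivative_zero[where v = "axis k 1" and G = "\<lambda>x. w k x - n k x * (h x - c)"])
    show "((\<lambda>s. w k (p + s *\<^sub>R axis k 1) - n k (p + s *\<^sub>R axis k 1) * (h (p + s *\<^sub>R axis k 1) - c))
        has_real_derivative G' k p) (at 0)" for p
    proof -
      have "((\<lambda>s. w k (p + s *\<^sub>R axis k 1) - n k p * (h (p + s *\<^sub>R axis k 1) - c)) has_real_derivative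
          (frechet_derivative (w k) (at p) (axis k 1) - n k p * (frechet_derivative h (at p) (axis k 1) - 0))) (at 0)"
        by (intro DERIV_diff DERIV_cmult has_real_derivative_line DERIV_const
            smooth_on_differentiable[OF w_smooth UNIV_I] smooth_on_differentiable[OF h(1) UNIV_I])
      then show ?thesis by (simp add: coeff_invariant G'_def partial_def)
    qed
    show "continuous_on UNIV (\<lambda>x. w k x - n k x * (h x - c))"
      by (intro continuous_intros smooth_on_continuous_on w_smooth h(1) coeff_cont)
    show "continuous_on UNIV (G' k)" by (rule G'_cont)
    show "w k p - n k p * (h p - c) = 0" if "p \<notin> cbox (-b) b" for p
    proof -
      have "p \<notin> K" using that b by blast
      then show ?thesis using c[OF that] off by (simp add: w_def fs_metric_def)
    qed
  qed
  moreover have "G' k integrable_on cbox (-b) b" for k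
    by (rule integrable_continuous[OF continuous_on_subset[OF G'_cont]]) simp
  ultimately have "integral (cbox (-b) b) (\<delta>' 0) = 0"
    by (simp add: \<delta>'0[abs_def] integral_sum)
  with deriv have "((\<lambda>t. integral K (\<lambda>x. sqrt (\<Delta> (t, x)))) has_real_derivative 0) (at 0)"
    by simp
  then show "((\<lambda>t. volume_on (F t) K) has_real_derivative 0) (at 0)"
    by (rule has_field_derivative_transform_within_open[where S = "{-\<epsilon><..<\<epsilon>}"])
      (use \<epsilon> vol in \<open>auto simp: abs_less_iff\<close>)
qed

end

section \<open>Weights attached to the roots of the cubic\<close>

text \<open>Vieta's formulas by divided differences: subtract the equations of two roots, cancel the
  nonzero difference, and repeat once.\<close>

lemma cubic_root_relations:
  fixes a B C :: real
  assumes "\<And>\<alpha>. \<alpha> \<in> {\<alpha>1, \<alpha>2, \<alpha>3} \<Longrightarrow> \<alpha>^3 + a * \<alpha>^2 - B * \<alpha> + C = 0"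
    and "\<alpha>1 \<noteq> \<alpha>2" "\<alpha>1 \<noteq> \<alpha>3" "\<alpha>2 \<noteq> \<alpha>3"
  shows "\<alpha>1 + \<alpha>2 + \<alpha>3 = - a" "\<alpha>1 * \<alpha>2 + \<alpha>1 * \<alpha>3 + \<alpha>2 * \<alpha>3 = - B" "\<alpha>1 * \<alpha>2 * \<alpha>3 = - C"
proof -
  have p: "\<alpha>1^3 + a * \<alpha>1^2 - B * \<alpha>1 + C = 0" "\<alpha>2^3 + a * \<alpha>2^2 - B * \<alpha>2 + C = 0"
    "\<alpha>3^3 + a * \<alpha>3^2 - B * \<alpha>3 + C = 0"
    using assms(1) by auto
  have "(\<alpha>1 - \<alpha>2) * (\<alpha>1^2 + \<alpha>1 * \<alpha>2 + \<alpha>2^2 + a * (\<alpha>1 + \<alpha>2) - B) = 0"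
    using p(1,2) by algebra
  then have q1: "\<alpha>1^2 + \<alpha>1 * \<alpha>2 + \<alpha>2^2 + a * (\<alpha>1 + \<alpha>2) - B = 0"
    using assms(2) by simp
  have "(\<alpha>1 - \<alpha>3) * (\<alpha>1^2 + \<alpha>1 * \<alpha>3 + \<alpha>3^2 + a * (\<alpha>1 + \<alpha>3) - B) = 0"
    using p(1,3) by algebra
  then have q2: "\<alpha>1^2 + \<alpha>1 * \<alpha>3 + \<alpha>3^2 + a * (\<alpha>1 + \<alpha>3) - B = 0"
    using assms(3) by simp
  have "(\<alpha>2 - \<alpha>3) * (\<alpha>1 + \<alpha>2 + \<alpha>3 + a) = 0"
    using q1 q2 by algebra
  then show e1: "\<alpha>1 + \<alpha>2 + \<alpha>3 = - a"
    using assms(4) by simp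
  show e2: "\<alpha>1 * \<alpha>2 + \<alpha>1 * \<alpha>3 + \<alpha>2 * \<alpha>3 = - B"
    using q1 e1 by algebra
  show "\<alpha>1 * \<alpha>2 * \<alpha>3 = - C"
    using p(1) e1 e2 by algebra
qed

lemma Lagrange_common_denominator:
  fixes a b c x y z :: "'a::field"
  assumes "a \<noteq> b" "a \<noteq> c" "b \<noteq> c"
  shows "x / ((a - b) * (a - c)) + y / ((b - a) * (b - c)) + z / ((c - a) * (c - b)) =
      (x * (b - c) - y * (a - c) + z * (a - b)) / ((a - b) * (a - c) * (b - c))"
proof -
  have d: "a - b \<noteq> 0" "a - c \<noteq> 0" "b - c \<noteq> 0" using assms by auto
  have m: "b - a = - (a - b)" "c - a = - (a - c)" "c - b = - (b - c)" by simp_all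
  show ?thesis
    unfolding m(1) m(2) m(3) using d by (simp add: divide_simps) (simp add: algebra_simps)
qed

text \<open>The first three are second divided differences of the functions 1, s and s^2. The fourth
  is Lagrange interpolation of the constant 1, evaluated at 0. The fifth is the second divided
  difference of 1 / (s - t).\<close>

lemma Lagrange_identities:
  fixes a b c :: "'a::field"
  assumes ne: "a \<noteq> b" "a \<noteq> c" "b \<noteq> c"
  shows "1 / ((a - b) * (a - c)) + 1 / ((b - a) * (b - c)) + 1 / ((c - a) * (c - b)) = 0"
    and "a / ((a - b) * (a - c)) + b / ((b - a) * (b - c)) + c / ((c - a) * (c - b)) = 0"
    and "a\<^sup>2 / ((a - b) * (a - c)) + b\<^sup>2 / ((b - a) * (b - c)) + c\<^sup>2 / ((c - a) * (c - b)) = 1"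
    and "b * c / ((a - b) * (a - c)) + a * c / ((b - a) * (b - c)) + a * b / ((c - a) * (c - b)) = 1"
    and "t \<noteq> a \<Longrightarrow> t \<noteq> b \<Longrightarrow> t \<noteq> c \<Longrightarrow> 1 / (a - t) / ((a - b) * (a - c)) +
      1 / (b - t) / ((b - a) * (b - c)) + 1 / (c - t) / ((c - a) * (c - b)) =
      1 / ((a - t) * (b - t) * (c - t))"
proof -
  have nz: "(a - b) * (a - c) * (b - c) \<noteq> 0" using ne by simp
  note r = Lagrange_common_denominator[OF ne]
  show "1 / ((a - b) * (a - c)) + 1 / ((b - a) * (b - c)) + 1 / ((c - a) * (c - b)) = 0"
    unfolding r using nz by (simp add: algebra_simps)
  show "a / ((a - b) * (a - c)) + b / ((b - a) * (b - c)) + c / ((c - a) * (c - b)) = 0"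
    unfolding r using nz by (simp add: algebra_simps)
  show "a\<^sup>2 / ((a - b) * (a - c)) + b\<^sup>2 / ((b - a) * (b - c)) + c\<^sup>2 / ((c - a) * (c - b)) = 1"
    unfolding r by (subst divide_eq_1_iff) (use nz in \<open>simp add: algebra_simps power2_eq_square\<close>)
  show "b * c / ((a - b) * (a - c)) + a * c / ((b - a) * (b - c)) + a * b / ((c - a) * (c - b)) = 1"
    unfolding r by (subst divide_eq_1_iff) (use nz in \<open>simp add: algebra_simps power2_eq_square\<close>)
  assume "t \<noteq> a" "t \<noteq> b" "t \<noteq> c"
  then have "1 / (a - t) * (b - c) - 1 / (b - t) * (a - c) + 1 / (c - t) * (a - b) =
      (a - b) * (a - c) * (b - c) / ((a - t) * (b - t) * (c - t))"
    by (simp add: divide_simps) (simp add: algebra_simps)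
  then show "1 / (a - t) / ((a - b) * (a - c)) +
      1 / (b - t) / ((b - a) * (b - c)) + 1 / (c - t) / ((c - a) * (c - b)) =
      1 / ((a - t) * (b - t) * (c - t))"
    unfolding r using nz by simp
qed

text \<open>The reciprocal of the weight is a sum of squares, which makes the weights positive.\<close>

lemma root_weight:
  fixes a b c1 c2 C B \<alpha> \<alpha>' \<alpha>'' \<beta> :: real
  assumes C: "C = a * c1 + b * c2 + 2 * c1^2 + 2 * c2^2" "C > 0"
    and B: "B = 2 * c1 * a + 3 * c1^2 + c2 * b + 3 * c2^2"
    and e: "\<alpha> + \<alpha>' + \<alpha>'' = - a" "\<alpha> * \<alpha>' + \<alpha> * \<alpha>'' + \<alpha>' * \<alpha>'' = - B" "\<alpha> * \<alpha>' * \<alpha>'' = - (c1 * C)"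
    and ne: "\<alpha> \<noteq> \<alpha>'" "\<alpha> \<noteq> \<alpha>''" "\<alpha> \<noteq> 0" "\<alpha> \<noteq> c1"
    and \<beta>: "\<beta> = c2 * \<alpha> / (\<alpha> - c1)"
  defines "w \<equiv> (C + \<alpha>' * \<alpha>'') / (C * (\<alpha> - \<alpha>') * (\<alpha> - \<alpha>''))"
  shows "\<alpha>\<^sup>2 + \<beta>\<^sup>2 = - a * \<alpha> - b * \<beta> + 2 * C" "w > 0"
    "w * \<beta> = c2 / ((\<alpha> - \<alpha>') * (\<alpha> - \<alpha>''))"
    "w * \<alpha> = (\<alpha> - c1) / ((\<alpha> - \<alpha>') * (\<alpha> - \<alpha>''))"
proof -
  have \<beta>': "\<beta> * (\<alpha> - c1) = c2 * \<alpha>" using \<beta> ne by simp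
  have p: "\<alpha>^3 + a * \<alpha>^2 - B * \<alpha> + c1 * C = 0" using e by algebra
  \<comment> \<open>Multiplying by the square of \<alpha> - c1 clears the denominator of \<beta>;
    what results is the cubic at \<alpha> times a linear factor.\<close>
  have "(\<alpha> - c1)^2 * (\<alpha>\<^sup>2 + \<beta>\<^sup>2 - (- a * \<alpha> - b * \<beta> + 2 * C)) =
      (\<alpha>\<^sup>2 + a * \<alpha> - 2 * C) * (\<alpha> - c1)^2 + (\<beta> * (\<alpha> - c1))\<^sup>2 + b * (\<beta> * (\<alpha> - c1)) * (\<alpha> - c1)"
    by algebra
  also have "\<dots> = (\<alpha>^3 + a * \<alpha>^2 - B * \<alpha> + c1 * C) * (\<alpha> - 2 * c1)"
    unfolding \<beta>' B C(1) by algebra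
  also have "\<dots> = 0" unfolding p by simp
  finally show norm: "\<alpha>\<^sup>2 + \<beta>\<^sup>2 = - a * \<alpha> - b * \<beta> + 2 * C" using ne by simp
  \<comment> \<open>The derivative of the cubic at its root \<alpha>.\<close>
  define d where "d = (\<alpha> - \<alpha>') * (\<alpha> - \<alpha>'')"
  have d: "d \<noteq> 0" using ne by (simp add: d_def)
  have "\<alpha> * (C + \<alpha>' * \<alpha>'') = C * (\<alpha> - c1)" using e(3) by algebra
  then have "C + \<alpha>' * \<alpha>'' = C * (\<alpha> - c1) / \<alpha>" using ne by (simp add: field_simps)
  then have w: "w = (\<alpha> - c1) / (\<alpha> * d)"
    using C(2) by (simp add: w_def d_def mult.assoc)
  show "w * \<beta> = c2 / ((\<alpha> - \<alpha>') * (\<alpha> - \<alpha>''))" "w * \<alpha> = (\<alpha> - c1) / ((\<alpha> - \<alpha>') * (\<alpha> - \<alpha>''))"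
    using ne d by (simp_all add: w \<beta> flip: d_def)
  \<comment> \<open>As \<open>w = (\<alpha> - c1) / (\<alpha> * d)\<close>, reaching
    \<open>\<alpha> * d\<close> here means
    \<open>w * (C + \<alpha>\<^sup>2 + \<beta>\<^sup>2) = 1\<close>.\<close>
  have "(\<alpha> - c1) * (C + \<alpha>\<^sup>2 + \<beta>\<^sup>2) = (\<alpha> - c1) * (3 * C - a * \<alpha>) - b * (\<beta> * (\<alpha> - c1))"
    using norm by algebra
  also have "\<dots> = \<alpha> * d"
  proof -
    have "d = 3 * \<alpha>\<^sup>2 + 2 * a * \<alpha> - B" unfolding d_def using e(1,2) by algebra
    moreover have "3 * C + a * c1 - b * c2 = 2 * B" unfolding B C(1) by algebra
    ultimately show ?thesis unfolding \<beta>' using p by algebra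
  qed
  finally have "w * (C + \<alpha>\<^sup>2 + \<beta>\<^sup>2) = 1"
    using ne d by (simp add: w)
  moreover have "C + \<alpha>\<^sup>2 + \<beta>\<^sup>2 > 0" using C(2) by (simp add: add_pos_nonneg)
  ultimately show "w > 0"
    by (metis zero_less_mult_pos2 zero_less_one)
qed

text \<open>By \<open>root_weight\<close>, multiplying a weight by \<alpha> or \<beta> gives
  \<alpha> - c1 or c2 over the Lagrange denominator. Each moment thus becomes a combination of
  \<open>Lagrange_identities\<close>.\<close>

lemma root_weights_orthonormal:
  fixes a b c1 c2 C B \<alpha>1 \<alpha>2 \<alpha>3 :: real
  assumes C: "C = a * c1 + b * c2 + 2 * c1^2 + 2 * c2^2" "C > 0"
    and B: "B = 2 * c1 * a + 3 * c1^2 + c2 * b + 3 * c2^2"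
    and root: "\<And>\<alpha>. \<alpha> \<in> {\<alpha>1, \<alpha>2, \<alpha>3} \<Longrightarrow> \<alpha>^3 + a * \<alpha>^2 - B * \<alpha> + c1 * C = 0"
    and ne: "\<alpha>1 \<noteq> \<alpha>2" "\<alpha>1 \<noteq> \<alpha>3" "\<alpha>2 \<noteq> \<alpha>3"
    and ne': "\<alpha>1 \<noteq> c1" "\<alpha>2 \<noteq> c1" "\<alpha>3 \<noteq> c1"
    and \<beta>: "\<beta>1 = c2 * \<alpha>1 / (\<alpha>1 - c1)" "\<beta>2 = c2 * \<alpha>2 / (\<alpha>2 - c1)" "\<beta>3 = c2 * \<alpha>3 / (\<alpha>3 - c1)"
  defines "w1 \<equiv> (C + \<alpha>2 * \<alpha>3) / (C * (\<alpha>1 - \<alpha>2) * (\<alpha>1 - \<alpha>3))"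
    and "w2 \<equiv> (C + \<alpha>1 * \<alpha>3) / (C * (\<alpha>2 - \<alpha>1) * (\<alpha>2 - \<alpha>3))"
    and "w3 \<equiv> (C + \<alpha>1 * \<alpha>2) / (C * (\<alpha>3 - \<alpha>1) * (\<alpha>3 - \<alpha>2))"
  shows "w1 > 0" "w2 > 0" "w3 > 0"
    and "\<alpha>1\<^sup>2 + \<beta>1\<^sup>2 = - a * \<alpha>1 - b * \<beta>1 + 2 * C"
    and "\<alpha>2\<^sup>2 + \<beta>2\<^sup>2 = - a * \<alpha>2 - b * \<beta>2 + 2 * C"
    and "\<alpha>3\<^sup>2 + \<beta>3\<^sup>2 = - a * \<alpha>3 - b * \<beta>3 + 2 * C"
    and "w1 + w2 + w3 = 1 / C"
    and "w1 * \<alpha>1 + w2 * \<alpha>2 + w3 * \<alpha>3 = 0"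
    and "w1 * \<beta>1 + w2 * \<beta>2 + w3 * \<beta>3 = 0"
    and "w1 * \<alpha>1\<^sup>2 + w2 * \<alpha>2\<^sup>2 + w3 * \<alpha>3\<^sup>2 = 1"
    and "w1 * (\<alpha>1 * \<beta>1) + w2 * (\<alpha>2 * \<beta>2) + w3 * (\<alpha>3 * \<beta>3) = 0"
    and "w1 * \<beta>1\<^sup>2 + w2 * \<beta>2\<^sup>2 + w3 * \<beta>3\<^sup>2 = 1"
proof -
  note e = cubic_root_relations[OF root ne]
  \<comment> \<open>The cubic takes the value \<open>- (c1 * c2\<^sup>2)\<close> at
    \<open>c1\<close>. As no root equals \<open>c1\<close>, both \<open>c1\<close> and
    \<open>c2\<close> are nonzero, and the product of the roots then shows that no root is
    zero.\<close>
  have pc1: "(\<alpha>1 - c1) * (\<alpha>2 - c1) * (\<alpha>3 - c1) = c1 * c2\<^sup>2"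
  proof -
    have "(\<alpha>1 - c1) * (\<alpha>2 - c1) * (\<alpha>3 - c1) = - (c1^3 + a * c1^2 - B * c1 + c1 * C)"
      using e by algebra
    also have "\<dots> = c1 * c2\<^sup>2" unfolding B C(1) by algebra
    finally show ?thesis .
  qed
  have c12: "c1 \<noteq> 0" "c2 \<noteq> 0" using pc1 ne' by auto
  have nz: "\<alpha>1 \<noteq> 0" "\<alpha>2 \<noteq> 0" "\<alpha>3 \<noteq> 0"
    using e(3) c12 C(2) by auto
  have e2: "\<alpha>2 + \<alpha>1 + \<alpha>3 = - a" "\<alpha>2 * \<alpha>1 + \<alpha>2 * \<alpha>3 + \<alpha>1 * \<alpha>3 = - B" "\<alpha>2 * \<alpha>1 * \<alpha>3 = - (c1 * C)"
    and e3: "\<alpha>3 + \<alpha>1 + \<alpha>2 = - a" "\<alpha>3 * \<alpha>1 + \<alpha>3 * \<alpha>2 + \<alpha>1 * \<alpha>2 = - B" "\<alpha>3 * \<alpha>1 * \<alpha>2 = - (c1 * C)"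
    using e by (simp_all add: algebra_simps)
  note r1 = root_weight[OF C B e ne(1,2) nz(1) ne'(1) \<beta>(1), folded w1_def]
  note r2 = root_weight[OF C B e2 ne(1)[symmetric] ne(3) nz(2) ne'(2) \<beta>(2), folded w2_def]
  note r3 = root_weight[OF C B e3 ne(2)[symmetric] ne(3)[symmetric] nz(3) ne'(3) \<beta>(3), folded w3_def]
  show "w1 > 0" "w2 > 0" "w3 > 0"
    "\<alpha>1\<^sup>2 + \<beta>1\<^sup>2 = - a * \<alpha>1 - b * \<beta>1 + 2 * C"
    "\<alpha>2\<^sup>2 + \<beta>2\<^sup>2 = - a * \<alpha>2 - b * \<beta>2 + 2 * C"
    "\<alpha>3\<^sup>2 + \<beta>3\<^sup>2 = - a * \<alpha>3 - b * \<beta>3 + 2 * C"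
    using r1 r2 r3 by blast+
  define d1 where "d1 = (\<alpha>1 - \<alpha>2) * (\<alpha>1 - \<alpha>3)"
  define d2 where "d2 = (\<alpha>2 - \<alpha>1) * (\<alpha>2 - \<alpha>3)"
  define d3 where "d3 = (\<alpha>3 - \<alpha>1) * (\<alpha>3 - \<alpha>2)"
  note d = d1_def[symmetric] d2_def[symmetric] d3_def[symmetric]
  note L = Lagrange_identities[OF ne, unfolded d]
  have L0: "x / d1 + x / d2 + x / d3 = 0" for x
  proof -
    have "x / d1 + x / d2 + x / d3 = x * (1 / d1 + 1 / d2 + 1 / d3)" by (simp add: algebra_simps)
    then show ?thesis unfolding L(1) by simp
  qed
  note r1 = r1[unfolded d] and r2 = r2[unfolded d] and r3 = r3[unfolded d]

  have "w1 = 1 / d1 + \<alpha>2 * \<alpha>3 / d1 / C" "w2 = 1 / d2 + \<alpha>1 * \<alpha>3 / d2 / C" "w3 = 1 / d3 + \<alpha>1 * \<alpha>2 / d3 / C"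
    using C(2) by (simp_all add: w1_def w2_def w3_def mult.assoc d add_divide_distrib mult.commute)
  then have "w1 + w2 + w3 = (1 / d1 + 1 / d2 + 1 / d3) + (\<alpha>2 * \<alpha>3 / d1 + \<alpha>1 * \<alpha>3 / d2 + \<alpha>1 * \<alpha>2 / d3) / C"
    by (simp add: add_divide_distrib)
  then show "w1 + w2 + w3 = 1 / C" unfolding L by simp
  show "w1 * \<alpha>1 + w2 * \<alpha>2 + w3 * \<alpha>3 = 0"
    using L(2) L0[of c1] r1(4) r2(4) r3(4) by (simp add: diff_divide_distrib)
  show "w1 * \<beta>1 + w2 * \<beta>2 + w3 * \<beta>3 = 0"
    using L0[of c2] r1(3) r2(3) r3(3) by simp
  have "w1 * \<alpha>1\<^sup>2 + w2 * \<alpha>2\<^sup>2 + w3 * \<alpha>3\<^sup>2 = (w1 * \<alpha>1) * \<alpha>1 + (w2 * \<alpha>2) * \<alpha>2 + (w3 * \<alpha>3) * \<alpha>3"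
    by (simp add: power2_eq_square)
  also have "\<dots> = (\<alpha>1\<^sup>2 / d1 + \<alpha>2\<^sup>2 / d2 + \<alpha>3\<^sup>2 / d3) - c1 * (\<alpha>1 / d1 + \<alpha>2 / d2 + \<alpha>3 / d3)"
    by (simp only: r1(4) r2(4) r3(4)) (simp add: power2_eq_square diff_divide_distrib algebra_simps)
  finally show "w1 * \<alpha>1\<^sup>2 + w2 * \<alpha>2\<^sup>2 + w3 * \<alpha>3\<^sup>2 = 1" unfolding L by simp
  have "w1 * (\<alpha>1 * \<beta>1) + w2 * (\<alpha>2 * \<beta>2) + w3 * (\<alpha>3 * \<beta>3) =
      (w1 * \<beta>1) * \<alpha>1 + (w2 * \<beta>2) * \<alpha>2 + (w3 * \<beta>3) * \<alpha>3"
    by simp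
  also have "\<dots> = c2 * (\<alpha>1 / d1 + \<alpha>2 / d2 + \<alpha>3 / d3)"
    by (simp only: r1(3) r2(3) r3(3)) (simp add: algebra_simps)
  finally show "w1 * (\<alpha>1 * \<beta>1) + w2 * (\<alpha>2 * \<beta>2) + w3 * (\<alpha>3 * \<beta>3) = 0" unfolding L by simp
  \<comment> \<open>Splits the second moment of \<beta> into a constant, killed by the first
    Lagrange identity, and a multiple of 1 / (\<alpha> - c1), evaluated by the fifth identity at
    \<open>c1\<close> and \<open>pc1\<close>.\<close>
  have \<beta>': "\<beta>1 = c2 + c1 * c2 / (\<alpha>1 - c1)" "\<beta>2 = c2 + c1 * c2 / (\<alpha>2 - c1)" "\<beta>3 = c2 + c1 * c2 / (\<alpha>3 - c1)"
    using ne' by (simp_all add: \<beta> field_simps)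
  have "w1 * \<beta>1\<^sup>2 + w2 * \<beta>2\<^sup>2 + w3 * \<beta>3\<^sup>2 = (w1 * \<beta>1) * \<beta>1 + (w2 * \<beta>2) * \<beta>2 + (w3 * \<beta>3) * \<beta>3"
    by (simp add: power2_eq_square)
  also have "\<dots> = (c2\<^sup>2 / d1 + c2\<^sup>2 / d2 + c2\<^sup>2 / d3) +
      c1 * c2\<^sup>2 * (1 / ((\<alpha>1 - c1) * d1) + 1 / ((\<alpha>2 - c1) * d2) + 1 / ((\<alpha>3 - c1) * d3))"
    by (simp only: r1(3) r2(3) r3(3)) (simp add: \<beta>' power2_eq_square algebra_simps)
  also have "1 / ((\<alpha>1 - c1) * d1) + 1 / ((\<alpha>2 - c1) * d2) + 1 / ((\<alpha>3 - c1) * d3) = 1 / (c1 * c2\<^sup>2)"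
    using L(5)[of c1] ne' unfolding pc1 by simp
  also have "c1 * c2\<^sup>2 * (1 / (c1 * c2\<^sup>2)) = 1" using c12 by simp
  finally show "w1 * \<beta>1\<^sup>2 + w2 * \<beta>2\<^sup>2 + w3 * \<beta>3\<^sup>2 = 1" unfolding L0 by simp
qed

section \<open>The equation for \<open>u\<close>\<close>

lemma smooth_on_DERIV:
  fixes f :: "real \<Rightarrow> real"
  assumes "smooth_on f UNIV"
  shows "(f has_real_derivative deriv f z) (at z)"
proof -
  have "f differentiable (at z)" by (rule smooth_on_differentiable[OF assms UNIV_I])
  then show ?thesis
    using DERIV_imp_deriv real_differentiable_def by metis
qed

lemma smooth_on_deriv:
  fixes f :: "real \<Rightarrow> real"
  assumes "smooth_on f UNIV"
  shows "smooth_on (deriv f) UNIV"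
proof -
  have "frechet_derivative f (at z) = (*) (deriv f z)" for z
    using frechet_derivative_at_eq smooth_on_DERIV[OF assms] unfolding has_field_derivative_def by blast
  then have "deriv f = (\<lambda>z. frechet_derivative f (at z) 1)" by auto
  then show ?thesis using smooth_on_derivative[OF assms] by simp
qed

lemma smooth_on_exp:
  fixes f :: "real \<Rightarrow> real"
  assumes "smooth_on f UNIV"
  shows "smooth_on (\<lambda>z. exp (f z)) UNIV"
proof (rule smooth_on_log_derivative)
  show "((\<lambda>z. exp (f z)) has_derivative (\<lambda>h. deriv f z * h * exp (f z))) (at z)" for z
    using DERIV_fun_exp[OF smooth_on_DERIV[OF assms], of z]
    unfolding has_field_derivative_def by (rule has_derivative_eq_rhs) (auto simp: mult_ac)
  show "smooth_on (\<lambda>z. deriv f z * h) UNIV" for h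
    by (intro smooth_on_mult smooth_on_deriv assms smooth_on_const open_UNIV)
qed simp

lemma DERIV_zero_function:
  assumes "\<And>z. f z = 0" "(f has_real_derivative D) (at z)"
  shows "D = 0"
proof -
  have "f = (\<lambda>z. 0)" using assms(1) by auto
  then show ?thesis using assms(2) DERIV_unique DERIV_const by blast
qed

text \<open>
  Differentiating \<open>v * g = 0\<close> up to three times forces \<open>v\<close>, \<open>v'\<close> and \<open>v''\<close> to vanish wherever
  \<open>g\<close> or \<open>g'\<close> does not. This covers constant solutions, where \<open>v = u' = 0\<close> and \<open>g \<noteq> 0\<close>.
\<close>

lemma deriv_zero_of_product_zero:
  fixes v g r :: "real \<Rightarrow> real"
  assumes v: "smooth_on v UNIV" and g: "smooth_on g UNIV"
    and vg: "\<And>z. v z * g z = 0"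
    and g': "\<And>z. deriv g z = deriv (deriv v) z + v z * r z"
  shows "deriv g z = 0"
proof -
  note [derivative_intros] = smooth_on_DERIV[OF v] smooth_on_DERIV[OF g]
    smooth_on_DERIV[OF smooth_on_deriv[OF v]] smooth_on_DERIV[OF smooth_on_deriv[OF g]]
    smooth_on_DERIV[OF smooth_on_deriv[OF smooth_on_deriv[OF v]]]
    smooth_on_DERIV[OF smooth_on_deriv[OF smooth_on_deriv[OF g]]]
  let ?v1 = "deriv v" and ?v2 = "deriv (deriv v)" and ?v3 = "deriv (deriv (deriv v))"
  let ?g1 = "deriv g" and ?g2 = "deriv (deriv g)" and ?g3 = "deriv (deriv (deriv g))"
  have 1: "?v1 z * g z + v z * ?g1 z = 0" for z
    by (rule DERIV_zero_function[of "\<lambda>z. v z * g z" _ z], rule vg) (auto intro!: derivative_eq_intros)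
  have 2: "?v2 z * g z + 2 * ?v1 z * ?g1 z + v z * ?g2 z = 0" for z
    by (rule DERIV_zero_function[of "\<lambda>z. ?v1 z * g z + v z * ?g1 z" _ z], rule 1) (auto intro!: derivative_eq_intros)
  have 3: "?v3 z * g z + 3 * ?v2 z * ?g1 z + 3 * ?v1 z * ?g2 z + v z * ?g3 z = 0" for z
    by (rule DERIV_zero_function[of "\<lambda>z. ?v2 z * g z + 2 * ?v1 z * ?g1 z + v z * ?g2 z" _ z], rule 2) (auto intro!: derivative_eq_intros)
  show ?thesis
  proof (cases "g z = 0")
    case False
    with vg[of z] 1[of z] 2[of z] have "v z = 0" "?v2 z = 0" by auto
    then show ?thesis by (simp add: g')
  next
    case True
    show ?thesis
    proof (rule ccontr)
      assume "?g1 z \<noteq> 0"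
      with True 1[of z] 2[of z] 3[of z] have "v z = 0" "?v2 z = 0" by auto
      then show False using \<open>?g1 z \<noteq> 0\<close> by (simp add: g')
    qed
  qed
qed

text \<open>By \<open>ode\<close> the difference of \<open>C\<close> and
  \<open>exp (2 * u z)\<close> is a sum of two squares, so \<open>nondegenerate\<close> makes it
  positive. The square root and the quotients in Q are then smooth.\<close>

locale profile =
  fixes u :: "real \<Rightarrow> real" and c3 C :: real
  assumes smooth_u: "smooth_on u UNIV"
    and ode: "(deriv u z)^2 + exp (2 * u z) + c3^2 * exp (-6 * u z) - C = 0"
    and nondegenerate: "exp (2 * u z) \<noteq> C"
begin

text \<open>
  \<open>lamP\<close> and \<open>lamQ\<close> are the logarithmic derivatives of \<open>P\<close> and \<open>Q\<close>. The quantity \<open>g\<close> vanishes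
  wherever \<open>u' \<noteq> 0\<close>, by differentiating the equation for \<open>u\<close>, but not for constant \<open>u\<close>. If \<open>c3 = 0\<close>,
  then \<open>u'\<close> has no zeros, so the value \<open>N = 0\<close> given by division by zero is the right one.
\<close>

definition "E z = exp (2 * u z)"
definition "U = deriv u"
definition "v z = c3 * exp (-3 * u z)"
definition "g z = deriv U z - 3 * (v z)\<^sup>2 + E z"
definition "lamP z = of_real (U z) + \<i> * of_real (v z)"
definition "lamP' z = of_real (deriv U z) + \<i> * of_real (- 3 * U z * v z)"
definition "lamQ z = of_real (- (E z / (C - E z))) * lamP z"
definition "lamQ' z = of_real (- (E z / (C - E z))) * lamP' z +
  of_real (- (2 * U z * E z * C / (C - E z)\<^sup>2)) * lamP z"
definition "N z = - (exp (4 * u z) * g z / c3)"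

lemma E_pos: "E z > 0" by (simp add: E_def)

lemma v_squared: "(v z)\<^sup>2 = c3^2 * exp (-6 * u z)"
  by (simp add: v_def power_mult_distrib power2_eq_square flip: exp_add)

lemma energy: "C - E z = (U z)\<^sup>2 + (v z)\<^sup>2"
  using ode[of z] by (simp add: v_squared E_def U_def)

lemma C_gt_E: "C - E z > 0"
proof -
  have "C - E z \<ge> 0" "C - E z \<noteq> 0"
    using energy[of z] nondegenerate[of z] by (auto simp: E_def)
  then show ?thesis by simp
qed

lemma C_pos: "C > 0"
  using C_gt_E[of 0] E_pos[of 0] by simp

lemma smooth_U: "smooth_on U UNIV"
  unfolding U_def by (rule smooth_on_deriv[OF smooth_u])

lemma smooth_E: "smooth_on E UNIV" and smooth_v: "smooth_on v UNIV"
  unfolding E_def[abs_def] v_def[abs_def]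
  by (intro smooth_on_exp smooth_on_mult smooth_on_const smooth_u open_UNIV)+

lemma u_DERIV [derivative_intros]: "(u has_real_derivative U z) (at z)"
  unfolding U_def by (rule smooth_on_DERIV[OF smooth_u])

lemma U_DERIV: "(U has_real_derivative deriv U z) (at z)"
  by (rule smooth_on_DERIV[OF smooth_U])

lemma E_DERIV: "(E has_real_derivative 2 * U z * E z) (at z)"
  unfolding E_def[abs_def] by (auto intro!: derivative_eq_intros)

lemma v_DERIV: "(v has_real_derivative - 3 * U z * v z) (at z)"
  unfolding v_def[abs_def] by (auto intro!: derivative_eq_intros)

lemma U_g: "U z * g z = 0"
proof -
  have "((\<lambda>z. (U z)\<^sup>2 + (v z)\<^sup>2 - (C - E z)) has_real_derivative
      2 * U z * deriv U z + 2 * v z * (- 3 * U z * v z) - (0 - 2 * U z * E z)) (at z)"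
    by (rule DERIV_cong, (rule DERIV_diff DERIV_add DERIV_power DERIV_const U_DERIV E_DERIV v_DERIV)+) simp
  then have "2 * U z * deriv U z + 2 * v z * (- 3 * U z * v z) - (0 - 2 * U z * E z) = 0"
    by (rule DERIV_zero_function[rotated]) (simp add: energy)
  then show ?thesis by (simp add: g_def power2_eq_square algebra_simps)
qed

lemma smooth_g: "smooth_on g UNIV"
  unfolding g_def[abs_def] power2_eq_square
  by (intro smooth_on_add smooth_on_diff smooth_on_mult smooth_on_const smooth_on_deriv
      smooth_U smooth_v smooth_E open_UNIV)

lemma g_deriv: "deriv g z = 0"
proof (rule deriv_zero_of_product_zero[OF smooth_U smooth_g U_g])
  fix z
  \<comment> \<open>The derivatives of \<open>v\<close> and \<open>E\<close> both carry the factor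
    \<open>U\<close>, which gives the shape that \<open>deriv_zero_of_product_zero\<close> asks
    for.\<close>
  have "(g has_real_derivative deriv (deriv U) z + U z * (18 * (v z)\<^sup>2 + 2 * E z)) (at z)"
    unfolding g_def[abs_def]
    by (auto intro!: derivative_eq_intros E_DERIV v_DERIV smooth_on_DERIV smooth_on_deriv smooth_U
        simp: power2_eq_square algebra_simps)
  then show "deriv g z = deriv (deriv U) z + U z * (18 * (v z)\<^sup>2 + 2 * E z)"
    by (rule DERIV_imp_deriv)
qed

text \<open>The derivative of the exponential brings the factor \<open>U * g\<close>, which
  vanishes, and \<open>g\<close> has derivative zero. This supplies the invariance of the third
  curvature coefficient.\<close>

lemma N_constant: "N z = N z'"
proof -
  have "(N has_real_derivative 0) (at z)" for z
  proof -
    have "(g has_real_derivative 0) (at z)"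
      using smooth_on_DERIV[OF smooth_g, of z] by (simp add: g_deriv)
    from DERIV_mult[OF DERIV_fun_exp[OF DERIV_cmult[OF u_DERIV]] this]
    have "((\<lambda>z. exp (4 * u z) * g z) has_real_derivative 0) (at z)"
      using U_g[of z] by (simp add: mult.assoc)
    from DERIV_cmult[OF this, of "- (1 / c3)"] show ?thesis
      by (simp add: N_def[abs_def])
  qed
  then show ?thesis by (intro DERIV_isconst_all) auto
qed

text \<open>For nonzero \<open>c3\<close> the real part is \<open>N * v = - exp u * g\<close> and
  the imaginary part is \<open>N * U = 0\<close>. For \<open>c3 = 0\<close> both sides vanish. It
  rewrites the defect \<open>g\<close> as an imaginary multiple of the logarithmic derivative, the
  form demanded by \<open>mean_curvature\<close>.\<close>

lemma N_lamP: "\<i> * of_real (N z) * lamP z = of_real (exp (u z) * g z)"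
proof (cases "c3 = 0")
  case True
  then have "v z = 0" by (metis v_def mult_zero_left)
  then have "U z \<noteq> 0" using energy[of z] C_gt_E[of z] by auto
  then have "g z = 0" using U_g[of z] by simp
  then show ?thesis by (simp add: N_def)
next
  case False
  have "exp (4 * u z) * exp (- (3 * u z)) = exp (u z)" by (simp flip: exp_add)
  then have "N z * v z = - (exp (u z) * g z)" using False by (simp add: N_def v_def)
  moreover have "N z * U z = 0" using U_g[of z] by (auto simp: N_def)
  ultimately show ?thesis by (simp add: lamP_def complex_eq_iff)
qed

lemma lamP_cnj: "lamP z * cnj (lamP z) = of_real (C - E z)"
  by (simp add: lamP_def energy complex_eq_iff power2_eq_square)

lemma lamP_has_vector_derivative: "(lamP has_vector_derivative lamP' z) (at z)"
proof -
  have "((\<lambda>z. of_real (U z) + \<i> * of_real (v z)) has_vector_derivative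
      of_real (deriv U z) + \<i> * of_real (- 3 * U z * v z)) (at z)"
    by (intro has_vector_derivative_add has_vector_derivative_mult_right has_vector_derivative_of_real
        U_DERIV v_DERIV)
  then show ?thesis by (simp only: lamP_def[abs_def] lamP'_def)
qed

lemma lamQ_has_vector_derivative: "(lamQ has_vector_derivative lamQ' z) (at z)"
proof -
  have "((\<lambda>z. - (E z / (C - E z))) has_real_derivative - (2 * U z * E z * C / (C - E z)\<^sup>2)) (at z)"
    using C_gt_E[of z] by (auto intro!: derivative_eq_intros E_DERIV simp: power2_eq_square algebra_simps)
  then show ?thesis
    unfolding lamQ_def[abs_def] lamQ'_def
    by (intro has_vector_derivative_mult has_vector_derivative_of_real lamP_has_vector_derivative
        has_real_derivative_iff_has_vector_derivative[THEN iffD1])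
qed

text \<open>Since \<open>U\<close> is the logarithmic derivative of \<sigma>, the left side is the
  z-derivative of \<sigma> times the z-derivative of one of the first three components, divided by
  \<sigma> and that component.\<close>

lemma lamP_riccati: "of_real (U z) * lamP z + lamP' z + (lamP z)\<^sup>2 = of_real (2 * C - 3 * E z + g z)"
  using energy[of z] by (simp add: lamP_def lamP'_def g_def complex_eq_iff power2_eq_square algebra_simps)

text \<open>The curvature equation for the fourth component, which does not depend on x and y; the
  summand 3 \<open>E\<close> is the multiplier of \<psi>.\<close>

lemma lamQ_riccati: "of_real (exp (u z)) * (of_real (U z) * lamQ z + lamQ' z + (lamQ z)\<^sup>2 + 3 * of_real (E z)) =
    \<i> * of_real (N z) * lamQ z"
proof -
  define D where "D = complex_of_real (C - E z)"
  have D: "D \<noteq> 0" using C_gt_E[of z] by (simp add: D_def)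
  \<comment> \<open>\<open>lamP z\<close> is a root of a real quadratic with trace 2
    \<open>U z\<close> and norm \<open>D\<close>, which eliminates its square; the Riccati equation
    eliminates \<open>lamP' z\<close>.\<close>
  have l: "lamP z * cnj (lamP z) = D" "cnj (lamP z) = 2 * of_real (U z) - lamP z"
    unfolding D_def by (rule lamP_cnj) (simp add: lamP_def complex_eq_iff)
  then have sq: "(lamP z)\<^sup>2 = 2 * of_real (U z) * lamP z - D"
    by (simp add: power2_eq_square algebra_simps)
  have ric: "lamP' z = 2 * D - of_real (E z) + of_real (g z) - of_real (U z) * lamP z - (lamP z)\<^sup>2"
    using lamP_riccati[of z] by (simp add: D_def algebra_simps)
  define e where "e = complex_of_real (E z)"
  define U' where "U' = complex_of_real (U z)"
  have Q: "lamQ z = - (e * lamP z / D)" "lamQ' z = - (e * lamP' z / D) - 2 * U' * e * (D + e) / D\<^sup>2 * lamP z"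
    using D by (simp_all add: lamQ_def lamQ'_def D_def e_def U'_def)
  have "D\<^sup>2 * (U' * lamQ z + lamQ' z + (lamQ z)\<^sup>2 + 3 * e) =
      - e * (D * (3 * U' * lamP z + lamP' z) + 2 * U' * e * lamP z - e * (lamP z)\<^sup>2 - 3 * D\<^sup>2)"
    unfolding Q using D by (simp add: field_simps power2_eq_square)
  also have "\<dots> = - e * (D * of_real (g z))"
    using sq ric unfolding e_def[symmetric] U'_def[symmetric] by algebra
  also have "\<dots> = D\<^sup>2 * (- (e * of_real (g z) / D))"
    using D by (simp add: field_simps power2_eq_square)
  finally have "of_real (U z) * lamQ z + lamQ' z + (lamQ z)\<^sup>2 + 3 * of_real (E z) = - (of_real (E z) * of_real (g z) / D)"
    using D unfolding e_def U'_def by (metis mult_left_cancel power_not_zero)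
  moreover have "\<i> * of_real (N z) * lamQ z = - (of_real (E z) * (\<i> * of_real (N z) * lamP z) / D)"
    by (simp add: lamQ_def D_def)
  ultimately show ?thesis by (simp add: N_lamP)
qed

end

section \<open>The immersion\<close>

lemma has_derivative_compose_nth:
  fixes f :: "real \<Rightarrow> 'b::real_normed_vector"
  assumes "(f has_vector_derivative f') (at (p $ i))"
  shows "((\<lambda>p. f (p $ i)) has_derivative (\<lambda>v. (v $ i) *\<^sub>R f')) (at p)"
proof -
  have "((\<lambda>p. p $ i) has_derivative (\<lambda>v. v $ i)) (at p)"
    by (rule bounded_linear_imp_has_derivative[OF bounded_linear_vec_nth])
  then show ?thesis
    using has_derivative_compose[of "\<lambda>p. p $ i" _ p UNIV f] assms
    unfolding has_vector_derivative_def by blast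
qed

lemma smooth_on_compose_nth:
  "smooth_on f UNIV \<Longrightarrow> smooth_on (\<lambda>p. f (p $ i)) UNIV"
  using smooth_on_compose_linear[OF open_UNIV bounded_linear_vec_nth, of f i] by simp

lemma smooth_on_of_real:
  "open S \<Longrightarrow> smooth_on f S \<Longrightarrow> smooth_on (\<lambda>x. complex_of_real (f x)) S"
  by (rule smooth_on_linear_compose[OF _ bounded_linear_of_real])

lemma partial_nth:
  fixes f :: "real^'n \<Rightarrow> complex^'m"
  assumes "smooth_on f UNIV"
  shows "partial f j p $ k = partial (\<lambda>q. f q $ k) j p"
  unfolding partial_def
  by (rule frechet_derivative_linear_compose[symmetric, OF bounded_linear_vec_nth
        smooth_on_differentiable[OF assms UNIV_I]])

section \<open>Maps with prescribed logarithmic derivatives and moduli\<close>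

context profile
begin

lemma smooth_lamP: "smooth_on lamP UNIV"
  unfolding lamP_def[abs_def]
  by (intro smooth_on_add smooth_on_mult smooth_on_const smooth_on_of_real smooth_U smooth_v open_UNIV)

lemma smooth_lamQ: "smooth_on lamQ UNIV"
proof -
  have "smooth_on (\<lambda>z. complex_of_real (- (E z * inverse (C - E z))) * lamP z) UNIV"
    using C_gt_E
    by (intro smooth_on_mult smooth_on_of_real smooth_lamP open_UNIV
        smooth_on_linear_compose[OF open_UNIV bounded_linear_minus[OF bounded_linear_ident]]
        smooth_on_inverse smooth_on_diff smooth_on_const smooth_E) (metis less_irrefl)
  then show ?thesis
    by (simp add: lamQ_def[abs_def] divide_inverse)
qed

text \<open>Only the logarithmic derivatives and the moduli of the components enter, not the
  antiderivatives. Horizontality and conformality reduce to weighted moments of \<open>A\<close> and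
  \<open>B\<close>; the curvature equation holds in each component separately.\<close>

lemma horizontal_conformal_liftI:
  fixes \<psi> :: "real^3 \<Rightarrow> complex^4" and A B w :: "4 \<Rightarrow> real" and a b :: real
  defines "M \<equiv> \<lambda>k. if k = 4 then lamQ else lamP"
  assumes d\<psi>: "\<And>k p. ((\<lambda>p. \<psi> p $ k) has_derivative (\<lambda>v. (\<i> * of_real (A k * v $ 1 + B k * v $ 2) +
      M k (p $ 3) * of_real (v $ 3)) * \<psi> p $ k)) (at p)"
    and sq: "\<And>k p. \<psi> p $ k * cnj (\<psi> p $ k) =
      of_real (if k = 4 then (C - E (p $ 3)) / C else w k * E (p $ 3))"
    and AB4: "A 4 = 0" "B 4 = 0"
    and AB: "\<And>k. k \<noteq> 4 \<Longrightarrow> (A k)\<^sup>2 + (B k)\<^sup>2 = - a * A k - b * B k + 2 * C"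
    and w: "w 1 + w 2 + w 3 = 1 / C"
      "w 1 * A 1 + w 2 * A 2 + w 3 * A 3 = 0"
      "w 1 * B 1 + w 2 * B 2 + w 3 * B 3 = 0"
      "w 1 * (A 1)\<^sup>2 + w 2 * (A 2)\<^sup>2 + w 3 * (A 3)\<^sup>2 = 1"
      "w 1 * (A 1 * B 1) + w 2 * (A 2 * B 2) + w 3 * (A 3 * B 3) = 0"
      "w 1 * (B 1)\<^sup>2 + w 2 * (B 2)\<^sup>2 + w 3 * (B 3)\<^sup>2 = 1"
  shows "horizontal_conformal_lift \<psi> (\<lambda>p. exp (u (p $ 3))) (\<lambda>p. 3 * E (p $ 3) * exp (u (p $ 3)))
    (\<lambda>k p. if k = 1 then - a * exp (u (p $ 3)) else if k = 2 then - b * exp (u (p $ 3)) else N (p $ 3))"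
proof -
  \<comment> \<open>The logarithmic derivative of component \<open>k\<close> in direction
    \<open>j\<close>, a function of the third coordinate alone.\<close>
  define L where "L k j z = (if j = 1 then \<i> * of_real (A k) else if j = 2 then \<i> * of_real (B k) else M k z)"
    for k and j :: 3 and z
  define M' where "M' k = (if k = 4 then lamQ' else lamP')" for k :: 4
  define L' where "L' k j z = (if j = 1 then 0 else if j = 2 then 0 else M' k z)" for k and j :: 3 and z
  have L_expand: "(\<i> * of_real (A k * v $ 1 + B k * v $ 2) + M k z * of_real (v $ 3)) =
      (\<Sum>j\<in>UNIV. L k j z * of_real (v $ j))" for k z and v :: "real^3"
    by (simp add: sum_3 L_def algebra_simps)
  have dM: "(M k has_vector_derivative M' k z) (at z)" for k z
    by (simp add: M_def M'_def lamP_has_vector_derivative lamQ_has_vector_derivative)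
  have dL: "((\<lambda>p. L k j (p $ 3)) has_derivative (\<lambda>v. (v $ 3) *\<^sub>R L' k j (p $ 3))) (at p)" for k j and p :: "real^3"
    by (auto simp: L_def L'_def intro: has_derivative_compose_nth[OF dM])
  have smooth_M: "smooth_on (M k) UNIV" for k
    by (simp add: M_def smooth_lamP smooth_lamQ)
  have smooth_k: "smooth_on (\<lambda>p. \<psi> p $ k) UNIV" for k
  proof (rule smooth_on_log_derivative[OF open_UNIV d\<psi>])
    show "smooth_on (\<lambda>p. \<i> * of_real (A k * v $ 1 + B k * v $ 2) + M k (p $ 3) * of_real (v $ 3)) UNIV"
      for v :: "real^3"
      by (intro smooth_on_add smooth_on_mult smooth_on_const smooth_on_compose_nth smooth_M open_UNIV)
  qed
  have smooth_\<psi>: "smooth_on \<psi> UNIV"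
    by (rule smooth_on_vec[OF open_UNIV smooth_k])
  define \<sigma> where "\<sigma> p = exp (u (p $ 3))" for p :: "real^3"
  have smooth_\<sigma>: "smooth_on \<sigma> UNIV"
    unfolding \<sigma>_def[abs_def] by (rule smooth_on_compose_nth[OF smooth_on_exp[OF smooth_u]])
  have d\<sigma>: "(\<sigma> has_derivative (\<lambda>v. v $ 3 *\<^sub>R (U (p $ 3) * \<sigma> p))) (at p)" for p
    unfolding \<sigma>_def[abs_def]
    by (rule has_derivative_compose_nth)
      (auto simp flip: has_real_derivative_iff_has_vector_derivative intro!: derivative_eq_intros)
  have \<sigma>E: "(\<sigma> p)\<^sup>2 = E (p $ 3)" for p
    by (simp add: \<sigma>_def E_def power2_eq_square flip: exp_add)
  have sum_axis: "(\<Sum>i\<in>UNIV. L k i z * of_real (axis j 1 $ i)) = L k j z" for k j z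
    by (simp add: axis_def if_distrib sum.delta cong: if_cong)
  have partial_\<psi>: "partial \<psi> j p $ k = L k j (p $ 3) * \<psi> p $ k" for j k p
    unfolding partial_nth[OF smooth_\<psi>]
    unfolding partial_def frechet_derivative_at_eq[OF d\<psi>] L_expand sum_axis ..
  have C0: "C \<noteq> 0" using C_pos by simp
  have herm_\<psi>: "herm (partial \<psi> j p) (\<psi> p) = (\<Sum>k\<in>UNIV. L k j (p $ 3) * (\<psi> p $ k * cnj (\<psi> p $ k)))" for j p
    by (simp add: herm_def partial_\<psi> mult.assoc)
  have herm_\<psi>\<psi>: "herm (partial \<psi> i p) (partial \<psi> j p) =
      (\<Sum>k\<in>UNIV. L k i (p $ 3) * cnj (L k j (p $ 3)) * (\<psi> p $ k * cnj (\<psi> p $ k)))" for i j p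
    by (simp add: herm_def partial_\<psi> mult_ac)
  have cw: "complex_of_real (w 1) + of_real (w 2) + of_real (w 3) = 1 / of_real C"
      "complex_of_real (w 1) * of_real (A 1) + of_real (w 2) * of_real (A 2) + of_real (w 3) * of_real (A 3) = 0"
      "complex_of_real (w 1) * of_real (B 1) + of_real (w 2) * of_real (B 2) + of_real (w 3) * of_real (B 3) = 0"
      "complex_of_real (w 1) * (of_real (A 1))\<^sup>2 + of_real (w 2) * (of_real (A 2))\<^sup>2 + of_real (w 3) * (of_real (A 3))\<^sup>2 = 1"
      "complex_of_real (w 1) * (of_real (A 1) * of_real (B 1)) + of_real (w 2) * (of_real (A 2) * of_real (B 2)) + of_real (w 3) * (of_real (A 3) * of_real (B 3)) = 0"
      "complex_of_real (w 1) * (of_real (B 1))\<^sup>2 + of_real (w 2) * (of_real (B 2))\<^sup>2 + of_real (w 3) * (of_real (B 3))\<^sup>2 = 1"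
    using w[THEN arg_cong[of _ _ complex_of_real]] by simp_all
  \<comment> \<open>Lets the fourth component balance the first three, of total weight
    \<open>1 / C\<close>, in the third direction.\<close>
  have lamQ_mult: "lamQ z * of_real (C - E z) = - of_real (E z) * lamP z" for z
  proof -
    have "lamQ z * of_real (C - E z) = of_real (- (E z / (C - E z)) * (C - E z)) * lamP z"
      by (simp only: lamQ_def of_real_mult mult_ac)
    also have "- (E z / (C - E z)) * (C - E z) = - E z" using C_gt_E[of z] by simp
    finally show ?thesis by simp
  qed
  \<comment> \<open>Neither \<sigma> nor \<open>L k j\<close> depends on the first two coordinates,
    so their own derivatives appear only for \<open>j = 3\<close>.\<close>
  have partial_second: "partial (\<lambda>q. \<sigma> q *\<^sub>R partial \<psi> j q) j p $ k = of_real (\<sigma> p) * ((L k j (p $ 3))\<^sup>2 +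
      (if j = 3 then of_real (U (p $ 3)) * L k j (p $ 3) + L' k j (p $ 3) else 0)) * \<psi> p $ k" for j k p
  proof -
    have "smooth_on (\<lambda>q. \<sigma> q *\<^sub>R partial \<psi> j q) UNIV"
      unfolding partial_def
      by (intro smooth_on_bilinear[OF open_UNIV bounded_bilinear_scaleR] smooth_\<sigma>
          smooth_on_derivative smooth_\<psi>)
    then have "partial (\<lambda>q. \<sigma> q *\<^sub>R partial \<psi> j q) j p $ k =
        partial (\<lambda>q. \<sigma> q *\<^sub>R (L k j (q $ 3) * \<psi> q $ k)) j p"
      by (simp add: partial_nth partial_\<psi>)
    also have "\<dots> = \<sigma> p *\<^sub>R (L k j (p $ 3) * (L k j (p $ 3) * \<psi> p $ k) +
        ((axis j 1 :: real^3) $ 3 *\<^sub>R L' k j (p $ 3)) * \<psi> p $ k) +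
        ((axis j 1 :: real^3) $ 3 *\<^sub>R (U (p $ 3) * \<sigma> p)) *\<^sub>R (L k j (p $ 3) * \<psi> p $ k)"
      unfolding partial_def
      by (subst frechet_derivative_at_eq[OF bounded_bilinear.FDERIV[OF bounded_bilinear_scaleR d\<sigma>
        has_derivative_mult[OF dL d\<psi>]]]) (simp only: L_expand sum_axis)
    finally show ?thesis
      by (simp add: axis_def scaleR_conv_of_real power2_eq_square algebra_simps)
  qed
  show ?thesis
    unfolding \<sigma>_def[symmetric]
  proof
    show "smooth_on \<psi> UNIV" "smooth_on \<sigma> UNIV" by (rule smooth_\<psi> smooth_\<sigma>)+
    show "\<sigma> p > 0" for p by (simp add: \<sigma>_def)
    show "\<psi> p \<in> S7" for p
    proof -
      have "herm (\<psi> p) (\<psi> p) = of_real ((w 1 + w 2 + w 3) * E (p $ 3) + (C - E (p $ 3)) / C)"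
        by (simp add: herm_def sum_4 sq algebra_simps)
      also have "\<dots> = 1" unfolding w(1) using C0 by (simp add: field_simps)
      finally show ?thesis by (rule S7I)
    qed
    show "herm (partial \<psi> j p) (\<psi> p) = 0" for j p
    proof -
      define e where "e = complex_of_real (E (p $ 3))"
      have "j = 1 \<or> j = 2 \<or> j = 3" by (rule exhaust_3)
      then show ?thesis
      proof (elim disjE)
        assume j: "j = 1"
        have "herm (partial \<psi> j p) (\<psi> p) = \<i> * e * (of_real (w 1) * of_real (A 1) +
            of_real (w 2) * of_real (A 2) + of_real (w 3) * of_real (A 3))"
          by (simp add: herm_\<psi> sum_4 sq L_def AB4 j e_def algebra_simps)
        then show ?thesis unfolding cw by simp
      next
        assume j: "j = 2"
        have "herm (partial \<psi> j p) (\<psi> p) = \<i> * e * (of_real (w 1) * of_real (B 1) +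
            of_real (w 2) * of_real (B 2) + of_real (w 3) * of_real (B 3))"
          by (simp add: herm_\<psi> sum_4 sq L_def AB4 j e_def algebra_simps)
        then show ?thesis unfolding cw by simp
      next
        assume j: "j = 3"
        have "herm (partial \<psi> j p) (\<psi> p) = lamP (p $ 3) * e * (of_real (w 1) + of_real (w 2) + of_real (w 3)) +
            lamQ (p $ 3) * of_real (C - E (p $ 3)) / of_real C"
          by (simp add: herm_\<psi> sum_4 sq L_def M_def j e_def algebra_simps)
        then show ?thesis unfolding cw lamQ_mult by (simp add: e_def)
      qed
    qed
    show "herm (partial \<psi> i p) (partial \<psi> j p) = (if i = j then of_real ((\<sigma> p)\<^sup>2) else 0)" for i j p
    proof -
      define e where "e = complex_of_real (E (p $ 3))"
      have h: "herm (partial \<psi> 1 p) (partial \<psi> 1 p) = e * (of_real (w 1) * (of_real (A 1))\<^sup>2 +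
            of_real (w 2) * (of_real (A 2))\<^sup>2 + of_real (w 3) * (of_real (A 3))\<^sup>2)"
        "herm (partial \<psi> 2 p) (partial \<psi> 2 p) = e * (of_real (w 1) * (of_real (B 1))\<^sup>2 +
            of_real (w 2) * (of_real (B 2))\<^sup>2 + of_real (w 3) * (of_real (B 3))\<^sup>2)"
        "herm (partial \<psi> 1 p) (partial \<psi> 2 p) = e * (of_real (w 1) * (of_real (A 1) * of_real (B 1)) +
            of_real (w 2) * (of_real (A 2) * of_real (B 2)) + of_real (w 3) * (of_real (A 3) * of_real (B 3)))"
        "herm (partial \<psi> 1 p) (partial \<psi> 3 p) = \<i> * e * cnj (lamP (p $ 3)) * (of_real (w 1) * of_real (A 1) +
            of_real (w 2) * of_real (A 2) + of_real (w 3) * of_real (A 3))"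
        "herm (partial \<psi> 2 p) (partial \<psi> 3 p) = \<i> * e * cnj (lamP (p $ 3)) * (of_real (w 1) * of_real (B 1) +
            of_real (w 2) * of_real (B 2) + of_real (w 3) * of_real (B 3))"
        by (simp_all add: herm_\<psi>\<psi> sum_4 sq L_def M_def AB4 e_def power2_eq_square algebra_simps)
      have "herm (partial \<psi> 3 p) (partial \<psi> 3 p) = e * (lamP (p $ 3) * cnj (lamP (p $ 3))) *
            (of_real (w 1) + of_real (w 2) + of_real (w 3)) +
            (lamQ (p $ 3) * of_real (C - E (p $ 3))) * cnj (lamQ (p $ 3)) / of_real C"
        by (simp add: herm_\<psi>\<psi> sum_4 sq L_def M_def e_def algebra_simps)
      also have "\<dots> = e * (lamP (p $ 3) * cnj (lamP (p $ 3)) - cnj (lamQ (p $ 3)) * lamP (p $ 3)) / of_real C"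
        unfolding cw lamQ_mult by (simp add: e_def algebra_simps diff_divide_distrib)
      also have "lamP (p $ 3) * cnj (lamP (p $ 3)) - cnj (lamQ (p $ 3)) * lamP (p $ 3) = of_real C"
      proof -
        have "cnj (lamQ (p $ 3)) * lamP (p $ 3) =
            of_real (- (E (p $ 3) / (C - E (p $ 3)))) * (lamP (p $ 3) * cnj (lamP (p $ 3)))"
          by (simp add: lamQ_def)
        also have "\<dots> = of_real (- E (p $ 3))"
          unfolding lamP_cnj of_real_mult[symmetric] of_real_eq_iff using C_gt_E[of "p $ 3"] by simp
        finally show ?thesis by (simp add: lamP_cnj)
      qed
      finally have h33: "herm (partial \<psi> 3 p) (partial \<psi> 3 p) = e" using C0 by simp
      note h = h[unfolded cw, simplified] h33
      have "herm (partial \<psi> 2 p) (partial \<psi> 1 p) = 0" "herm (partial \<psi> 3 p) (partial \<psi> 1 p) = 0"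
        "herm (partial \<psi> 3 p) (partial \<psi> 2 p) = 0"
        using h by (simp_all add: herm_cnj[of "partial \<psi> 2 p" "partial \<psi> 1 p"]
            herm_cnj[of "partial \<psi> 3 p" "partial \<psi> 1 p"] herm_cnj[of "partial \<psi> 3 p" "partial \<psi> 2 p"])
      with h show ?thesis
        using exhaust_3[of i] exhaust_3[of j] by (auto simp: \<sigma>E e_def)
    qed
    show "(\<Sum>j\<in>UNIV. partial (\<lambda>q. \<sigma> q *\<^sub>R partial \<psi> j q) j p) = - (3 * E (p $ 3) * \<sigma> p) *\<^sub>R \<psi> p +
      (\<Sum>j\<in>UNIV. (\<i> * of_real (if j = 1 then - a * \<sigma> p else if j = 2 then - b * \<sigma> p else N (p $ 3))) *s partial \<psi> j p)" for p
    proof -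
      have "(\<Sum>j\<in>UNIV. partial (\<lambda>q. \<sigma> q *\<^sub>R partial \<psi> j q) j p $ k) =
          of_real (\<sigma> p) * (- (of_real (A k))\<^sup>2 - (of_real (B k))\<^sup>2 +
            (of_real (U (p $ 3)) * M k (p $ 3) + M' k (p $ 3) + (M k (p $ 3))\<^sup>2)) * \<psi> p $ k" for k
        unfolding partial_second
        by (simp add: sum_3 L_def L'_def power2_eq_square algebra_simps)
      \<comment> \<open>For \<open>k = 4\<close> this is \<open>lamQ_riccati\<close>. Otherwise
        \<open>AB\<close> turns the negated squares into a A + b B - 2 C, and the last term cancels
        against the 2 C of \<open>lamP_riccati\<close>.\<close>
      also have "\<dots> k = (- (3 * of_real (E (p $ 3)) * of_real (\<sigma> p)) + of_real (a * \<sigma> p * A k) +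
          of_real (b * \<sigma> p * B k) + \<i> * of_real (N (p $ 3)) * M k (p $ 3)) * \<psi> p $ k" for k
      proof (cases "k = 4")
        case True
        then show ?thesis
          using lamQ_riccati[of "p $ 3"] by (simp add: AB4 M_def M'_def \<sigma>_def) (simp add: algebra_simps)
      next
        case False
        have "(of_real (A k))\<^sup>2 + (of_real (B k))\<^sup>2 = complex_of_real (- a * A k - b * B k + 2 * C)"
          unfolding AB[OF False, symmetric] by simp
        then have q: "- (of_real (A k))\<^sup>2 - (of_real (B k))\<^sup>2 = - complex_of_real (- a * A k - b * B k + 2 * C)"
          by (simp add: algebra_simps)
        show ?thesis
          unfolding q using False
          by (simp add: M_def M'_def lamP_riccati N_lamP \<sigma>_def) (simp add: algebra_simps)
      qed
      finally have *: "(\<Sum>j\<in>UNIV. partial (\<lambda>q. \<sigma> q *\<^sub>R partial \<psi> j q) j p $ k) =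
        (- (3 * of_real (E (p $ 3)) * of_real (\<sigma> p)) + of_real (a * \<sigma> p * A k) +
          of_real (b * \<sigma> p * B k) + \<i> * of_real (N (p $ 3)) * M k (p $ 3)) * \<psi> p $ k" for k .
      show ?thesis
        unfolding vec_eq_iff
      proof
        fix k
        show "(\<Sum>j\<in>UNIV. partial (\<lambda>q. \<sigma> q *\<^sub>R partial \<psi> j q) j p) $ k = (- (3 * E (p $ 3) * \<sigma> p) *\<^sub>R \<psi> p +
          (\<Sum>j\<in>UNIV. (\<i> * of_real (if j = 1 then - a * \<sigma> p else if j = 2 then - b * \<sigma> p else N (p $ 3))) *s partial \<psi> j p)) $ k"
          unfolding sum_component *
          by (simp add: sum_3 partial_\<psi> L_def scaleR_conv_of_real[of _ "\<psi> p $ k"] algebra_simps)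
      qed
    qed
    show "continuous_on UNIV (\<lambda>p. if k = 1 then - a * \<sigma> p else if k = 2 then - b * \<sigma> p else N (p $ 3))" for k :: 3
    proof -
      have "(\<lambda>p. N (p $ 3)) = (\<lambda>p::real^3. N 0)" using N_constant by blast
      then have "continuous_on UNIV (\<lambda>p::real^3. N (p $ 3))" by (simp only: continuous_on_const)
      moreover have "continuous_on UNIV (\<lambda>p. c * \<sigma> p)" for c
        by (intro continuous_intros smooth_on_continuous_on smooth_\<sigma>)
      ultimately show ?thesis
        by (cases "k = 1"; cases "k = 2") (simp_all only: simp_thms if_True if_False)
    qed
    \<comment> \<open>The first two coefficients are functions of the third coordinate and the third
      is constant, so each is constant along its own axis.\<close>
    show "(if k = 1 then - a * \<sigma> (p + s *\<^sub>R axis k 1) else if k = 2 then - b * \<sigma> (p + s *\<^sub>R axis k 1)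
        else N ((p + s *\<^sub>R axis k 1) $ 3)) =
      (if k = 1 then - a * \<sigma> p else if k = 2 then - b * \<sigma> p else N (p $ 3))" for k :: 3 and p s
      using N_constant by (auto simp: \<sigma>_def axis_def)
  qed
qed

end

theorem theorem3p3:
  fixes a b c1 c2 c3 \<CC> \<BB> :: real
    and \<alpha>1 \<alpha>2 \<alpha>3 \<beta>1 \<beta>2 \<beta>3 \<gamma>1 \<gamma>2 \<gamma>3 \<gamma>4 :: real
    and u I1 I2 :: "real \<Rightarrow> real"
    and P Q :: "real \<Rightarrow> complex"
    and \<psi> :: "real^3 \<Rightarrow> complex^4"
  assumes "\<CC> = a * c1 + b * c2 + 2 * c1^2 + 2 * c2^2"
    and "\<BB> = 2 * c1 * a + 3 * c1^2 + c2 * b + 3 * c2^2"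
    and "smooth_on u UNIV"
    and "\<And>z. (deriv u z)^2 + exp (2 * u z) + c3^2 * exp (-6 * u z) - \<CC> = 0"
    and "\<And>\<alpha>. \<alpha> \<in> {\<alpha>1, \<alpha>2, \<alpha>3} \<Longrightarrow> \<alpha>^3 + a * \<alpha>^2 - \<BB> * \<alpha> + c1 * \<CC> = 0"
    and "\<alpha>1 \<noteq> \<alpha>2" "\<alpha>1 \<noteq> \<alpha>3" "\<alpha>2 \<noteq> \<alpha>3"
    and "\<alpha>1 \<noteq> c1" "\<alpha>2 \<noteq> c1" "\<alpha>3 \<noteq> c1"
    and "\<beta>1 = c2 * \<alpha>1 / (\<alpha>1 - c1)"
    and "\<beta>2 = c2 * \<alpha>2 / (\<alpha>2 - c1)"
    and "\<beta>3 = c2 * \<alpha>3 / (\<alpha>3 - c1)"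
    and "\<And>z. exp (2 * u z) \<noteq> \<CC>"
    and "\<And>z. (I1 has_real_derivative exp (-3 * u z)) (at z)"
    and "\<And>z. (I2 has_real_derivative exp (- u z) / (exp (2 * u z) - \<CC>)) (at z)"
    and "\<And>z. P z = exp (u z + \<i> * c3 * I1 z)"
    and "\<And>z. Q z = sqrt (\<CC> - exp (2 * u z)) * exp (\<i> * c3 * I2 z)"
    and "\<gamma>1 = sqrt ((\<CC> + \<alpha>2 * \<alpha>3) / (\<CC> * (\<alpha>1 - \<alpha>2) * (\<alpha>1 - \<alpha>3)))"
    and "\<gamma>2 = sqrt ((\<CC> + \<alpha>1 * \<alpha>3) / (\<CC> * (\<alpha>2 - \<alpha>1) * (\<alpha>2 - \<alpha>3)))"
    and "\<gamma>3 = sqrt ((\<CC> + \<alpha>1 * \<alpha>2) / (\<CC> * (\<alpha>3 - \<alpha>1) * (\<alpha>3 - \<alpha>2)))"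
    and "\<gamma>4 = sqrt (1 / \<CC>)"
    and "\<And>x y z. \<psi> (vector [x, y, z]) =
           vector [\<gamma>1 * P z * exp (\<i> * (x * \<alpha>1 + y * \<beta>1)),
                   \<gamma>2 * P z * exp (\<i> * (x * \<alpha>2 + y * \<beta>2)),
                   \<gamma>3 * P z * exp (\<i> * (x * \<alpha>3 + y * \<beta>3)),
                   \<gamma>4 * Q z]"
  shows "(\<forall>p. \<psi> p \<in> S7) \<and>
         Lagrangian_immersion (hopf \<circ> \<psi>) \<and>
         conformally_flat (hopf \<circ> \<psi>) \<and>
         H_minimal (hopf \<circ> \<psi>)"
proof -
  note C = assms(1) and B = assms(2) and root = assms(5) and ne = assms(6-8) and ne' = assms(9-11)
    and \<beta> = assms(12-14) and I1 = assms(16) and I2 = assms(17) and P = assms(18) and Q = assms(19)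
    and \<gamma> = assms(20-23) and \<psi> = assms(24)
  interpret profile u c3 \<CC>
    by unfold_locales (use assms(3,4,15) in auto)
  note on = root_weights_orthonormal[OF C C_pos B root ne ne' \<beta>]
  define A where "A k = (if k = 1 then \<alpha>1 else if k = 2 then \<alpha>2 else if k = 3 then \<alpha>3 else 0)" for k :: 4
  define Bt where "Bt k = (if k = 1 then \<beta>1 else if k = 2 then \<beta>2 else if k = 3 then \<beta>3 else 0)" for k :: 4
  define w where "w k = (if k = 1 then \<gamma>1\<^sup>2 else if k = 2 then \<gamma>2\<^sup>2 else \<gamma>3\<^sup>2)" for k :: 4
  define \<gamma> where "\<gamma> k = (if k = 1 then \<gamma>1 else if k = 2 then \<gamma>2 else if k = 3 then \<gamma>3 else \<gamma>4)" for k :: 4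
  \<comment> \<open>The weights are positive, so the square roots are genuine and squaring returns
    the weights.\<close>
  have \<gamma>2: "\<gamma>1\<^sup>2 = (\<CC> + \<alpha>2 * \<alpha>3) / (\<CC> * (\<alpha>1 - \<alpha>2) * (\<alpha>1 - \<alpha>3))"
    "\<gamma>2\<^sup>2 = (\<CC> + \<alpha>1 * \<alpha>3) / (\<CC> * (\<alpha>2 - \<alpha>1) * (\<alpha>2 - \<alpha>3))"
    "\<gamma>3\<^sup>2 = (\<CC> + \<alpha>1 * \<alpha>2) / (\<CC> * (\<alpha>3 - \<alpha>1) * (\<alpha>3 - \<alpha>2))"
    "\<gamma>4\<^sup>2 = 1 / \<CC>"
    unfolding assms(20-23) using on(1-3) C_pos by (simp_all add: less_imp_le)
  define R where "R k = (if k = 4 then Q else P)" for k :: 4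
  have \<psi>_nth: "\<psi> p $ k = of_real (\<gamma> k) * R k (p $ 3) * exp (\<i> * of_real (p $ 1 * A k + p $ 2 * Bt k))" for p k
  proof -
    have "p = vector [p $ 1, p $ 2, p $ 3]"
      by (simp add: vec_eq_iff forall_3)
    then have "\<psi> p = vector [\<gamma>1 * P (p $ 3) * exp (\<i> * (p $ 1 * \<alpha>1 + p $ 2 * \<beta>1)),
                   \<gamma>2 * P (p $ 3) * exp (\<i> * (p $ 1 * \<alpha>2 + p $ 2 * \<beta>2)),
                   \<gamma>3 * P (p $ 3) * exp (\<i> * (p $ 1 * \<alpha>3 + p $ 2 * \<beta>3)),
                   \<gamma>4 * Q (p $ 3)]"
      using \<psi> by metis
    then show ?thesis
      using exhaust_4[of k] by (auto simp: vector_def \<gamma>_def A_def Bt_def R_def)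
  qed
  define M where "M k = (if k = 4 then lamQ else lamP)" for k :: 4
  have unit: "exp (\<i> * of_real x) * cnj (exp (\<i> * of_real x)) = 1" for x
    by (simp add: exp_cnj flip: exp_add)
  have dR: "(R k has_vector_derivative M k z * R k z) (at z)" for k z
  proof (cases "k = 4")
    case False
    have "((\<lambda>z. of_real (u z) + \<i> * of_real c3 * of_real (I1 z)) has_vector_derivative
        of_real (U z) + \<i> * of_real c3 * of_real (exp (-3 * u z))) (at z)"
      by (intro has_vector_derivative_add has_vector_derivative_mult_right has_vector_derivative_of_real
          u_DERIV I1)
    from field_vector_diff_chain_at[OF this DERIV_exp]
    show ?thesis
      using False by (simp add: R_def M_def lamP_def v_def P[abs_def] o_def mult.assoc)
  next
    case True
    have pos: "\<CC> - E z > 0" by (rule C_gt_E)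
    \<comment> \<open>The logarithmic derivative of the modulus of \<open>Q\<close> is the real part
      of \<open>lamQ\<close>.\<close>
    have s: "((\<lambda>z. sqrt (\<CC> - E z)) has_real_derivative - (U z * E z / (\<CC> - E z)) * sqrt (\<CC> - E z)) (at z)"
    proof -
      have "((\<lambda>z. sqrt (\<CC> - E z)) has_real_derivative (0 - 2 * U z * E z) * (inverse (sqrt (\<CC> - E z)) / 2)) (at z)"
        using DERIV_chain2[where f = sqrt and g = "\<lambda>z. \<CC> - E z" and x = z,
            OF DERIV_real_sqrt[OF pos] DERIV_diff[OF DERIV_const E_DERIV]]
        by (simp add: mult.commute)
      moreover have "(0 - 2 * U z * E z) * (inverse (sqrt (\<CC> - E z)) / 2) =
          - (U z * E z / (\<CC> - E z)) * sqrt (\<CC> - E z)"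
        using pos by (simp add: field_simps)
      ultimately show ?thesis by simp
    qed
    have "((\<lambda>z. \<i> * of_real c3 * of_real (I2 z)) has_vector_derivative
        \<i> * of_real c3 * of_real (exp (- u z) / (exp (2 * u z) - \<CC>))) (at z)"
      by (intro has_vector_derivative_mult_right has_vector_derivative_of_real I2)
    from field_vector_diff_chain_at[OF this DERIV_exp]
    have e: "((\<lambda>z. exp (\<i> * of_real c3 * of_real (I2 z))) has_vector_derivative
        \<i> * of_real c3 * of_real (exp (- u z) / (exp (2 * u z) - \<CC>)) * exp (\<i> * of_real c3 * of_real (I2 z))) (at z)"
      by (simp add: o_def)
    \<comment> \<open>Since \<open>E z * v z = c3 * exp (- u z)\<close>, the phase of
      \<open>Q\<close> varies at the rate given by the imaginary part of
      \<open>lamQ\<close>.\<close>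
    have "c3 * (exp (- u z) / (exp (2 * u z) - \<CC>)) = - (E z * v z / (\<CC> - E z))"
    proof -
      have "exp (2 * u z) * exp (- (3 * u z)) = exp (- u z)" by (simp flip: exp_add)
      then have "E z * v z = c3 * exp (- u z)" by (simp add: E_def v_def)
      then show ?thesis using pos by (simp add: E_def divide_simps) (simp add: algebra_simps)
    qed
    then have l: "lamQ z = of_real (- (U z * E z / (\<CC> - E z))) +
        \<i> * of_real c3 * of_real (exp (- u z) / (exp (2 * u z) - \<CC>))"
      unfolding mult.assoc of_real_mult[symmetric]
      by (simp only:) (simp add: lamQ_def lamP_def algebra_simps add_divide_distrib)
    have "(Q has_vector_derivative lamQ z * Q z) (at z)"
    proof -
      have Q': "Q = (\<lambda>z. of_real (sqrt (\<CC> - E z)) * exp (\<i> * of_real c3 * of_real (I2 z)))"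
        by (simp add: fun_eq_iff Q E_def)
      show ?thesis
        unfolding Q' by (rule has_vector_derivative_eq_rhs,
            rule has_vector_derivative_mult[OF has_vector_derivative_of_real[OF s] e])
          (simp add: l algebra_simps)
    qed
    then show ?thesis using True by (simp add: R_def M_def)
  qed
  have sqR: "R k z * cnj (R k z) = of_real (if k = 4 then \<CC> - E z else E z)" for k z
    proof -
    have "P z * cnj (P z) = of_real (exp (u z) * exp (u z)) * (exp (\<i> * of_real (c3 * I1 z)) * cnj (exp (\<i> * of_real (c3 * I1 z))))"
      by (simp add: P exp_add exp_of_real mult_ac)
    then have "P z * cnj (P z) = of_real (E z)"
      unfolding unit by (simp add: E_def flip: exp_add)
    moreover have "Q z * cnj (Q z) = of_real (sqrt (\<CC> - E z) * sqrt (\<CC> - E z)) *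
        (exp (\<i> * of_real (c3 * I2 z)) * cnj (exp (\<i> * of_real (c3 * I2 z))))"
      by (simp only: Q E_def complex_cnj_mult complex_cnj_complex_of_real of_real_mult mult_ac)
    then have "Q z * cnj (Q z) = of_real (\<CC> - E z)"
      unfolding unit using C_gt_E[of z] by simp
    ultimately show ?thesis by (simp add: R_def)
  qed
  interpret horizontal_conformal_lift \<psi> "\<lambda>p. exp (u (p $ 3))" "\<lambda>p. 3 * E (p $ 3) * exp (u (p $ 3))"
    "\<lambda>k p. if k = 1 then - a * exp (u (p $ 3)) else if k = 2 then - b * exp (u (p $ 3)) else N (p $ 3)"
  proof (rule horizontal_conformal_liftI[of \<psi> A Bt w])
    show "((\<lambda>p. \<psi> p $ k) has_derivative (\<lambda>v. (\<i> * of_real (A k * v $ 1 + Bt k * v $ 2) +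
      (if k = 4 then lamQ else lamP) (p $ 3) * of_real (v $ 3)) * \<psi> p $ k)) (at p)" for k p
      proof -
      let ?e = "\<lambda>p::real^3. exp (\<i> * of_real (p $ 1 * A k + p $ 2 * Bt k))"
      have "((\<lambda>p::real^3. \<i> * of_real (p $ 1 * A k + p $ 2 * Bt k)) has_derivative
          (\<lambda>v. \<i> * of_real (v $ 1 * A k + v $ 2 * Bt k))) (at p)"
        by (intro has_derivative_mult_right has_derivative_of_real has_derivative_add has_derivative_mult_left
            bounded_linear_imp_has_derivative[OF bounded_linear_vec_nth])
      from has_derivative_compose[OF this DERIV_exp[THEN has_field_derivative_imp_has_derivative]]
      have e: "(?e has_derivative (\<lambda>v. ?e p * (\<i> * of_real (v $ 1 * A k + v $ 2 * Bt k)))) (at p)" .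
      have "((\<lambda>p. of_real (\<gamma> k) * R k (p $ 3) * ?e p) has_derivative
          (\<lambda>v. of_real (\<gamma> k) * R k (p $ 3) * (?e p * (\<i> * of_real (v $ 1 * A k + v $ 2 * Bt k))) +
            of_real (\<gamma> k) * (v $ 3 *\<^sub>R (M k (p $ 3) * R k (p $ 3))) * ?e p)) (at p)"
        by (intro has_derivative_mult has_derivative_mult_right has_derivative_compose_nth dR e)
      then show ?thesis
        unfolding \<psi>_nth by (rule has_derivative_eq_rhs)
          (auto simp: M_def scaleR_conv_of_real algebra_simps)
    qed
    show "\<psi> p $ k * cnj (\<psi> p $ k) =
      of_real (if k = 4 then (\<CC> - E (p $ 3)) / \<CC> else w k * E (p $ 3))" for k p
      proof -
      have "\<psi> p $ k * cnj (\<psi> p $ k) = of_real ((\<gamma> k)\<^sup>2) * (R k (p $ 3) * cnj (R k (p $ 3))) *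
          (exp (\<i> * of_real (p $ 1 * A k + p $ 2 * Bt k)) * cnj (exp (\<i> * of_real (p $ 1 * A k + p $ 2 * Bt k))))"
        by (simp only: \<psi>_nth complex_cnj_mult complex_cnj_complex_of_real power2_eq_square of_real_mult mult_ac)
      then show ?thesis
        unfolding unit sqR using exhaust_4[of k] arg_cong[OF \<gamma>2(4), of complex_of_real]
        by (auto simp: \<gamma>_def w_def)
    qed
    show "A 4 = 0" "Bt 4 = 0" by (simp_all add: A_def Bt_def)
    show "(A k)\<^sup>2 + (Bt k)\<^sup>2 = - a * A k - b * Bt k + 2 * \<CC>" if "k \<noteq> 4" for k
      using on(4-6) exhaust_4[of k] that by (auto simp: A_def Bt_def)
  qed (use on(7-12) in \<open>simp_all add: w_def A_def Bt_def \<gamma>2\<close>)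
  show ?thesis
    using sphere Lagrangian_hopf conformally_flat_hopf H_minimal_hopf by blast
qed

end
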